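(* Let $k\ge1$, let $\mathbf{a}=(a_1,\dots,a_k)$ be a $k$-tuple of non-negative integers with $a_1=1$, and let $\mathbf{n}=(n_1,n_2,\dots,n_k)$, $\mathbf{n}'=(n_1',n_2,\dots,n_k)$ and $\mathbf{n}''=(n_1'',n_2,\dots,n_k)$ be $k$-tuples of non-negative integers with $n_1=n_1'+n_1''+1$. Let $s=s'+s''$, $t=t'+t''$ and $v$, where $s',s'',t',t'',v$ are non-negative integers. Suppose that $(\mathbf{n}';\mathbf{a};s';t';v+s'')$ and $(\mathbf{n}'';\mathbf{a};s'';t'';v+s')$ are both subabundant (resp. both superabundant). If the statements $S(\mathbf{n}';\mathbf{a};s';t';v+s'')$ and $S(\mathbf{n}'';\mathbf{a};s'';t'';v+s')$ are true, then $(\mathbf{n};\mathbf{a};s;t;v)$ is subabundant (resp. superabundant) and $S(\mathbf{n};\mathbf{a};s;t;v)$ is true.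
   Context: We work over $\mathbb{C}$. For $k$-tuples $\mathbf{n},\mathbf{a}$ of non-negative integers, $\mathbb{P}^{\mathbf{n}}=\prod_{i=1}^k\mathbb{P}^{n_i}$ and $N=N(\mathbf{n},\mathbf{a})=\prod_{i=1}^k\binom{n_i+a_i}{a_i}=\dim H^0(\mathbb{P}^{\mathbf{n}},\mathcal{O}(\mathbf{a}))$. For a zero-dimensional subscheme $Z\subset\mathbb{P}^{\mathbf{n}}$, its Hilbert function at $\mathbf{a}$ is $h_{\mathbb{P}^{\mathbf{n}}}(Z,\mathbf{a})=\dim H^0(\mathbb{P}^{\mathbf{n}},\mathcal{O}(\mathbf{a}))-\dim H^0(\mathbb{P}^{\mathbf{n}},\mathcal{I}_Z(\mathbf{a}))$. For a point $p$, the double point $p^2$ is the subscheme with ideal sheaf $\mathcal{I}_p^2$. Assume $a_1=1$ and let $\pi:\mathbb{P}^{\mathbf{n}}\to\prod_{i=2}^k\mathbb{P}^{n_i}$ be the canonical projection. For $p\in\mathbb{P}^{\mathbf{n}}$ let $f_p$ be the double point $p^2$ restricted to (i.e. intersected with) the fibre $\pi^{-1}(\pi(p))\cong\mathbb{P}^{n_1}$; it has degree $n_1+1$. For non-negative integers $s,t,v$, take general points $p_1,\dots,p_s,q_1,\dots,q_t,r_1,\dots,r_v\in\mathbb{P}^{\mathbf{n}}$ and let $Z=\{p_1^2,\dots,p_s^2,q_1,\dots,q_t,f_{r_1},\dots,f_{r_v}\}$, a scheme of degree $s(1+\sum_{i=1}^k n_i)+t+v(n_1+1)$. The tuple $(\mathbf{n};\mathbf{a};s;t;v)$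 is called subabundant if $s(1+\sum_i n_i)+t+v(n_1+1)\le N$ and superabundant if $s(1+\sum_i n_i)+t+v(n_1+1)\ge N$. The statement $S(\mathbf{n};\mathbf{a};s;t;v)$ is said to be true if $h_{\mathbb{P}^{\mathbf{n}}}(Z,\mathbf{a})=\min\{s(1+\sum_{i=1}^k n_i)+t+v(n_1+1),\ N\}$. *)

theory Defs
  imports Complex_Main "HOL-Library.Poly_Mapping" "HOL-Library.FuncSet"
    "HOL-Algebra.Ideal_Product"
begin

section \<open>Polynomials\<close>

text \<open>
  Multivariate polynomials over the complex numbers, with the ring structure of
  \<open>HOL-Library.Poly_Mapping\<close>. The variable \<open>(i, j)\<close> is the \<open>j\<close>-th homogeneous coordinate
  on the \<open>i\<close>-th projective factor.
\<close>

type_synonym 'v cpoly = "('v \<Rightarrow>\<^sub>0 nat) \<Rightarrow>\<^sub>0 complex"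

definition poly_eval :: "('v \<Rightarrow> complex) \<Rightarrow> 'v cpoly \<Rightarrow> complex" where
  "poly_eval x f = (\<Sum>m\<in>Poly_Mapping.keys f.
     Poly_Mapping.lookup f m * (\<Prod>v\<in>Poly_Mapping.keys m. x v ^ Poly_Mapping.lookup m v))"

definition poly_scale :: "complex \<Rightarrow> 'v cpoly \<Rightarrow> 'v cpoly" where
  "poly_scale c f = Poly_Mapping.map ((*) c) f"

lemma vector_space_poly_scale: "vector_space (poly_scale :: complex \<Rightarrow> 'v cpoly \<Rightarrow> 'v cpoly)"
proof -
  have eq: "poly_scale c f = Poly_Mapping.single 0 c * f" for c and f :: "'v cpoly"
    by (simp add: poly_scale_def mult_map_scale_conv_mult)
  show ?thesis
  proof
    fix b c :: complex and f g :: "'v cpoly"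
    show "poly_scale c (f + g) = poly_scale c f + poly_scale c g"
      unfolding eq by (rule distrib_left)
    show "poly_scale (b + c) f = poly_scale b f + poly_scale c f"
      unfolding eq single_add by (rule distrib_right)
    show "poly_scale b (poly_scale c f) = poly_scale (b * c) f"
      unfolding eq mult.assoc[symmetric] mult_single by simp
    show "poly_scale 1 f = f"
      unfolding eq by simp
  qed
qed

definition coord_vars :: "'i set \<Rightarrow> ('i \<Rightarrow> nat) \<Rightarrow> ('i \<times> nat) set" where
  "coord_vars I n = (SIGMA i:I. {..n i})"

text \<open>The multigraded coordinate ring of the product of the \<open>\<P>\<^bsup>n i\<^esup>\<close> over \<open>i \<in> I\<close>.\<close>

definition coord_ring :: "'i set \<Rightarrow> ('i \<Rightarrow> nat) \<Rightarrow> ('i \<times> nat) cpoly ring" where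
  "coord_ring I n = \<lparr>carrier =
       {f. \<forall>m\<in>Poly_Mapping.keys f. Poly_Mapping.keys m \<subseteq> coord_vars I n},
     mult = (*), one = 1, zero = 0, add = (+)\<rparr>"

lemma cring_coord_ring: "cring (coord_ring I n)"
proof -
  let ?C = "{f :: ('a \<times> nat) cpoly. \<forall>m\<in>Poly_Mapping.keys f. Poly_Mapping.keys m \<subseteq> coord_vars I n}"
  have add: "f + g \<in> ?C" if "f \<in> ?C" "g \<in> ?C" for f g
    using that Poly_Mapping.keys_add[of f g] by blast
  have mult: "f * g \<in> ?C" if "f \<in> ?C" "g \<in> ?C" for f g
  proof (intro CollectI ballI)
    fix m assume "m \<in> Poly_Mapping.keys (f * g)"
    then have "m \<in> {a + b | a b. a \<in> Poly_Mapping.keys f \<and> b \<in> Poly_Mapping.keys g}"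
      by (rule subsetD[OF keys_mult])
    then obtain a b where ab: "m = a + b" "a \<in> Poly_Mapping.keys f" "b \<in> Poly_Mapping.keys g"
      by blast
    then have "Poly_Mapping.keys a \<subseteq> coord_vars I n" "Poly_Mapping.keys b \<subseteq> coord_vars I n"
      using that by blast+
    then show "Poly_Mapping.keys m \<subseteq> coord_vars I n"
      using Poly_Mapping.keys_add[of a b] unfolding ab(1) by blast
  qed
  have neg: "- f \<in> ?C" if "f \<in> ?C" for f
    using that by (simp add: in_keys_iff)
  have sel: "carrier (coord_ring I n) = ?C" "mult (coord_ring I n) = (*)"
    "one (coord_ring I n) = 1" "zero (coord_ring I n) = 0" "add (coord_ring I n) = (+)"
    by (simp_all add: coord_ring_def)
  have zero: "0 \<in> ?C" and one: "1 \<in> ?C"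
    by simp_all
  show ?thesis
  proof (rule cringI)
    show "abelian_group (coord_ring I n)"
    proof (rule abelian_groupI, unfold sel)
      show "\<exists>g\<in>?C. g + f = 0" if "f \<in> ?C" for f
        by (rule bexI[OF _ neg[OF that]]) (rule left_minus)
    qed (rule add zero add.assoc add.commute add_0_left; assumption?)+
    show "comm_monoid (coord_ring I n)"
      by (rule comm_monoidI, unfold sel)
        (rule mult one mult.assoc mult.commute mult_1_left; assumption?)+
  qed (unfold sel, rule distrib_right)
qed

text \<open>\<open>forms I n a\<close> is the space of multihomogeneous polynomials of multidegree \<open>a\<close>
  (with zero), i.e. the space of global sections of \<open>\<O>(a)\<close>.\<close>

definition forms :: "'i set \<Rightarrow> ('i \<Rightarrow> nat) \<Rightarrow> ('i \<Rightarrow> nat) \<Rightarrow> ('i \<times> nat) cpoly set" where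
  "forms I n a = {f \<in> carrier (coord_ring I n).
     \<forall>m\<in>Poly_Mapping.keys f. \<forall>i\<in>I. (\<Sum>j\<le>n i. Poly_Mapping.lookup m (i, j)) = a i}"


section \<open>Multiprojective spaces\<close>

text \<open>The points of \<open>\<P>\<^sup>n\<close> are the classes, up to nonzero scalars, of nonzero vectors indexed
  by \<open>0, \<dots>, n\<close>, extended by zero.\<close>

definition nonzero_vectors :: "nat \<Rightarrow> (nat \<Rightarrow> complex) set" where
  "nonzero_vectors n = {u. (\<exists>j. u j \<noteq> 0) \<and> (\<forall>j>n. u j = 0)}"

definition scaling_rel :: "((nat \<Rightarrow> complex) \<times> (nat \<Rightarrow> complex)) set" where
  "scaling_rel = {(u, w). \<exists>c. c \<noteq> 0 \<and> w = (\<lambda>j. c * u j)}"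

definition proj_space :: "nat \<Rightarrow> (nat \<Rightarrow> complex) set set" where
  "proj_space n = nonzero_vectors n // scaling_rel"

type_synonym 'i mpoint = "'i \<Rightarrow> (nat \<Rightarrow> complex) set"

definition mproj_space :: "'i set \<Rightarrow> ('i \<Rightarrow> nat) \<Rightarrow> 'i mpoint set" where
  "mproj_space I n = (\<Pi>\<^sub>E i\<in>I. proj_space (n i))"

definition homog_coords :: "'i set \<Rightarrow> 'i mpoint \<Rightarrow> ('i \<times> nat \<Rightarrow> complex) set" where
  "homog_coords I P = {x. \<forall>i\<in>I. (\<lambda>j. x (i, j)) \<in> P i}"

text \<open>Only used for multihomogeneous \<open>f\<close>, where all choices of homogeneous coordinates agree.\<close>

definition vanishes_at :: "'i set \<Rightarrow> ('i \<times> nat) cpoly \<Rightarrow> 'i mpoint \<Rightarrow> bool" where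
  "vanishes_at I f P \<longleftrightarrow> (\<forall>x\<in>homog_coords I P. poly_eval x f = 0)"

definition zariski_open :: "'i set \<Rightarrow> ('i \<Rightarrow> nat) \<Rightarrow> 'i mpoint set \<Rightarrow> bool" where
  "zariski_open I n U \<longleftrightarrow>
     (\<exists>T. T \<subseteq> (\<Union>d. forms I n d) \<and>
          U = {P \<in> mproj_space I n. \<exists>f\<in>T. \<not> vanishes_at I f P})"


section \<open>Closed subschemes and their Hilbert functions\<close>

text \<open>
  A closed subscheme is given by a multihomogeneous ideal \<open>J\<close> of the coordinate ring, not
  necessarily saturated; its ideal sheaf is the sheaf associated with \<open>J\<close>. Under this
  association powers, sums and finite intersections of ideals correspond to those of ideal
  sheaves, that is, to infinitesimal neighbourhoods, intersections and unions of subschemes.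
\<close>

definition vanishing_ideal ::
    "'i set \<Rightarrow> ('i \<Rightarrow> nat) \<Rightarrow> 'i mpoint set \<Rightarrow> ('i \<times> nat) cpoly set" where
  "vanishing_ideal I n X =
     genideal (coord_ring I n) {f \<in> (\<Union>d. forms I n d). \<forall>P\<in>X. vanishes_at I f P}"

text \<open>
  Global sections of \<open>\<I>\<^sub>Z(a)\<close>, for the ideal sheaf \<open>\<I>\<^sub>Z\<close> associated with \<open>J\<close>: the forms \<open>F\<close>
  of multidegree \<open>a\<close> whose germ at every point \<open>P\<close> lies in the stalk at \<open>P\<close>, i.e. is a
  fraction \<open>G / g\<close> with \<open>G \<in> J\<close> and \<open>g\<close> multihomogeneous with \<open>g(P) \<noteq> 0\<close>.
\<close>

definition ideal_sections ::
    "'i set \<Rightarrow> ('i \<Rightarrow> nat) \<Rightarrow> ('i \<times> nat) cpoly set \<Rightarrow> ('i \<Rightarrow> nat) \<Rightarrow> ('i \<times> nat) cpoly set" where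
  "ideal_sections I n J a = {F \<in> forms I n a.
     \<forall>P\<in>mproj_space I n. \<exists>g\<in>(\<Union>d. forms I n d). \<not> vanishes_at I g P \<and> g * F \<in> J}"

text \<open>The subtraction does not truncate: the second space is contained in the first, which is
  finite dimensional for finite \<open>I\<close>.\<close>

definition hilbert_function ::
    "'i set \<Rightarrow> ('i \<Rightarrow> nat) \<Rightarrow> ('i \<times> nat) cpoly set \<Rightarrow> ('i \<Rightarrow> nat) \<Rightarrow> nat" where
  "hilbert_function I n J a =
     vector_space.dim poly_scale (forms I n a)
       - vector_space.dim poly_scale (ideal_sections I n J a)"


section \<open>Points, double points and fibre double points\<close>

text \<open>From here on the projective factors are indexed by \<open>{1..k}\<close>.\<close>

definition point_ideal :: "nat \<Rightarrow> (nat \<Rightarrow> nat) \<Rightarrow> nat mpoint \<Rightarrow> (nat \<times> nat) cpoly set" where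
  "point_ideal k n P = vanishing_ideal {1..k} n {P}"

definition double_point_ideal ::
    "nat \<Rightarrow> (nat \<Rightarrow> nat) \<Rightarrow> nat mpoint \<Rightarrow> (nat \<times> nat) cpoly set" where
  "double_point_ideal k n P =
     ideal_prod (coord_ring {1..k} n) (point_ideal k n P) (point_ideal k n P)"

definition proj_tail :: "nat \<Rightarrow> nat mpoint \<Rightarrow> nat mpoint" where
  "proj_tail k P = restrict P {2..k}"

definition fibre :: "nat \<Rightarrow> (nat \<Rightarrow> nat) \<Rightarrow> nat mpoint \<Rightarrow> nat mpoint set" where
  "fibre k n P = {Q \<in> mproj_space {1..k} n. proj_tail k Q = proj_tail k P}"

definition fibre_double_point_ideal ::
    "nat \<Rightarrow> (nat \<Rightarrow> nat) \<Rightarrow> nat mpoint \<Rightarrow> (nat \<times> nat) cpoly set" where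
  "fibre_double_point_ideal k n P =
     double_point_ideal k n P
       <+>\<^bsub>coord_ring {1..k} n\<^esub> vanishing_ideal {1..k} n (fibre k n P)"

text \<open>The scheme consisting of the double points at \<open>p 0, \<dots>, p (s - 1)\<close>, the reduced points
  \<open>q 0, \<dots>, q (t - 1)\<close> and the fibre double points at \<open>r 0, \<dots>, r (v - 1)\<close>.\<close>

definition config_ideal ::
    "nat \<Rightarrow> (nat \<Rightarrow> nat) \<Rightarrow> nat \<Rightarrow> nat \<Rightarrow> nat \<Rightarrow> (nat \<Rightarrow> nat mpoint) \<Rightarrow> (nat \<Rightarrow> nat mpoint) \<Rightarrow>
     (nat \<Rightarrow> nat mpoint) \<Rightarrow> (nat \<times> nat) cpoly set" where
  "config_ideal k n s t v p q r =
     carrier (coord_ring {1..k} n)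
       \<inter> (\<Inter>l<s. double_point_ideal k n (p l))
       \<inter> (\<Inter>l<t. point_ideal k n (q l))
       \<inter> (\<Inter>l<v. fibre_double_point_ideal k n (r l))"


section \<open>The statement \<open>S(n; a; s; t; v)\<close>\<close>

definition expected_sections :: "nat \<Rightarrow> (nat \<Rightarrow> nat) \<Rightarrow> (nat \<Rightarrow> nat) \<Rightarrow> nat" where
  "expected_sections k n a = (\<Prod>i\<in>{1..k}. (n i + a i) choose (a i))"

definition config_degree :: "nat \<Rightarrow> (nat \<Rightarrow> nat) \<Rightarrow> nat \<Rightarrow> nat \<Rightarrow> nat \<Rightarrow> nat" where
  "config_degree k n s t v = s * (1 + (\<Sum>i\<in>{1..k}. n i)) + t + v * (n 1 + 1)"

definition subabundant ::
    "nat \<Rightarrow> (nat \<Rightarrow> nat) \<Rightarrow> (nat \<Rightarrow> nat) \<Rightarrow> nat \<Rightarrow> nat \<Rightarrow> nat \<Rightarrow> bool" where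
  "subabundant k n a s t v \<longleftrightarrow> config_degree k n s t v \<le> expected_sections k n a"

definition superabundant ::
    "nat \<Rightarrow> (nat \<Rightarrow> nat) \<Rightarrow> (nat \<Rightarrow> nat) \<Rightarrow> nat \<Rightarrow> nat \<Rightarrow> nat \<Rightarrow> bool" where
  "superabundant k n a s t v \<longleftrightarrow> config_degree k n s t v \<ge> expected_sections k n a"

text \<open>
  An \<open>m\<close>-tuple of points of \<open>\<P>\<^bsup>n\<^esup>\<close> is a point of \<open>(\<P>\<^bsup>n\<^esup>)\<^bsup>m\<^esup>\<close>, the multiprojective space whose
  factors are indexed by \<open>{..<m} \<times> {1..k}\<close>.
\<close>

definition tuple_point :: "nat \<Rightarrow> (nat \<times> nat) mpoint \<Rightarrow> nat \<Rightarrow> nat mpoint" where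
  "tuple_point k x l = (\<lambda>i\<in>{1..k}. x (l, i))"

text \<open>A property holds for general points of \<open>\<P>\<^bsup>n\<^esup>\<close> if it holds for all tuples in some nonempty
  Zariski open subset of \<open>(\<P>\<^bsup>n\<^esup>)\<^bsup>m\<^esup>\<close>.\<close>

definition for_general_points ::
    "nat \<Rightarrow> (nat \<Rightarrow> nat) \<Rightarrow> nat \<Rightarrow> ((nat \<Rightarrow> nat mpoint) \<Rightarrow> bool) \<Rightarrow> bool" where
  "for_general_points k n m Q \<longleftrightarrow>
     (\<exists>U. zariski_open ({..<m} \<times> {1..k}) (\<lambda>(l, i). n i) U \<and> U \<noteq> {} \<and>
          (\<forall>x\<in>U. Q (tuple_point k x)))"

text \<open>The first \<open>s\<close> of the \<open>s + t + v\<close> general points are the \<open>p\<close>'s, the next \<open>t\<close> the \<open>q\<close>'s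
  and the last \<open>v\<close> the \<open>r\<close>'s.\<close>

definition S_true ::
    "nat \<Rightarrow> (nat \<Rightarrow> nat) \<Rightarrow> (nat \<Rightarrow> nat) \<Rightarrow> nat \<Rightarrow> nat \<Rightarrow> nat \<Rightarrow> bool" where
  "S_true k n a s t v \<longleftrightarrow>
     for_general_points k n (s + t + v) (\<lambda>P.
       hilbert_function {1..k} n
         (config_ideal k n s t v P (\<lambda>l. P (s + l)) (\<lambda>l. P (s + t + l))) a
       = min (config_degree k n s t v) (expected_sections k n a))"

end

theory Submission
  imports Defs "Jordan_Normal_Form.Determinant"
begin

text \<open>
  Split the coordinates of the first factor into two blocks of \<open>n' 1 + 1\<close> and \<open>n'' 1 + 1\<close>
  coordinates. As \<open>a 1 = 1\<close>, a form of multidegree \<open>a\<close> is the sum of a form in the first block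
  and a form in the second. Specialize \<open>s'\<close> double points and \<open>t'\<close> simple points to the first
  coordinate subspace and the others to the second. Since forms are linear in the first factor,
  the conditions decouple: a double point in one subspace imposes a double point on the component
  there and a fibre double point on the other component, while a fibre double point imposes one on
  both. Hence the specialized linear system has dimension at most the sum of those of the two given
  systems. The dimension is upper semicontinuous, and it never drops below the expected one, so a
  general configuration behaves as claimed.
\<close>

section \<open>Common kernels of linear functionals\<close>

text \<open>The obstacle is that the two hypotheses concern configurations that are general
  independently of each other, whereas the specialization couples them: the common fibre double
  points must have the same tail (image in the factors other than the first) on both sides, and the
  tail of each double point on one side must be the tail of a fibre double point on the other. So
  good choices have to be found inside the locus of matching tails. Nothing else is shared: as
  \<open>a 1 = 1\<close>, a derivative along the first factor does not depend on the position in
  that factor, so the first coordinates stay free.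

  The ideals are used only to show that membership amounts to the vanishing of values and first
  derivatives. After that the argument is linear algebra with functionals that depend polynomially
  on the points, and semicontinuity is the nonvanishing of a minor.

  The two systems must deviate in the same direction because \<open>min d' N' + min d'' N''\<close>
  then equals \<open>min (d' + d'') (N' + N'')\<close>; in the mixed case it can be smaller.\<close>

context vector_space
begin

text \<open>\<open>dim\<close> is the cardinality of a basis, hence 0 if the basis is infinite. The
  finite spanning set \<open>B\<close> of the ambient space excludes this, here and in the lemmas
  below.\<close>

lemma dim_mono_finite:
  assumes "finite B" "T \<subseteq> span B" "S \<subseteq> T"
  shows "dim S \<le> dim T"
proof -
  obtain C where C: "C \<subseteq> T" "independent C" "T \<subseteq> span C" "card C = dim T"
    by (rule basis_exists)
  have "finite C"
    using independent_span_bound[OF assms(1) C(2)] C(1) assms(2) by blast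
  then show ?thesis
    using dim_le_card[of S C] C assms(3) by auto
qed

lemma dim_le_kernel:
  assumes "finite B" "W \<subseteq> span B" "subspace W"
    and add: "\<And>x y. x \<in> W \<Longrightarrow> y \<in> W \<Longrightarrow> \<phi> (x + y) = \<phi> x + \<phi> y"
    and scale: "\<And>c x. x \<in> W \<Longrightarrow> \<phi> (c *s x) = c * \<phi> x"
  shows "dim W \<le> dim {w \<in> W. \<phi> w = 0} + 1"
proof (cases "\<forall>w\<in>W. \<phi> w = 0")
  case True
  then have "{w \<in> W. \<phi> w = 0} = W"
    by auto
  then show ?thesis
    by simp
next
  case False
  then obtain f where f: "f \<in> W" "\<phi> f \<noteq> 0"
    by blast
  obtain C where C: "C \<subseteq> {w \<in> W. \<phi> w = 0}" "independent C" "{w \<in> W. \<phi> w = 0} \<subseteq> span C"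
      "card C = dim {w \<in> W. \<phi> w = 0}"
    by (rule basis_exists)
  have fin: "finite C"
    using independent_span_bound[OF assms(1) C(2)] C(1) assms(2) by blast
  have "W \<subseteq> span (insert f C)"
  proof
    fix w assume w: "w \<in> W"
    \<comment> \<open>Subtracting this multiple of \<open>f\<close> moves \<open>w\<close> into the
      kernel, so \<open>f\<close> and a basis of the kernel span \<open>W\<close>.\<close>
    define c where "c = \<phi> w / \<phi> f"
    have W: "(- c) *s f \<in> W" "w + (- c) *s f \<in> W"
      using w f assms(3) by (meson subspace_scale subspace_add)+
    have "\<phi> (w + (- c) *s f) = 0"
      unfolding add[OF w W(1)] scale[OF f(1)] using f by (simp add: c_def)
    then have "w + (- c) *s f \<in> span C"
      using W C(3) by blast
    then have "w + (- c) *s f \<in> span (insert f C)"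
      using span_mono[of C "insert f C"] by blast
    moreover have "c *s f \<in> span (insert f C)"
      by (simp add: span_base span_scale)
    ultimately have "(w + (- c) *s f) + c *s f \<in> span (insert f C)"
      by (rule span_add)
    then show "w \<in> span (insert f C)"
      by simp
  qed
  then have "dim W \<le> card (insert f C)"
    using fin by (simp add: dim_le_card)
  also have "\<dots> \<le> card C + 1"
    using fin by (simp add: card_insert_if)
  finally show ?thesis
    using C(4) by simp
qed

lemma subspace_kernel_on:
  assumes "subspace W"
    and add: "\<And>x y. x \<in> W \<Longrightarrow> y \<in> W \<Longrightarrow> \<phi> (x + y) = \<phi> x + \<phi> y"
    and scale: "\<And>c x. x \<in> W \<Longrightarrow> \<phi> (c *s x) = c * \<phi> x"
  shows "subspace {w \<in> W. \<phi> w = 0}"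
proof -
  have "\<phi> 0 = 0"
    using scale[of 0 0] subspace_0[OF assms(1)] by simp
  then show ?thesis
    using subspace_0[OF assms(1)] subspace_add[OF assms(1)] subspace_scale[OF assms(1)]
    by (auto simp: subspace_def add scale)
qed

lemma dim_le_common_kernel:
  assumes "finite B" "W \<subseteq> span B" "subspace W" "finite C"
    and add: "\<And>c x y. c \<in> C \<Longrightarrow> x \<in> W \<Longrightarrow> y \<in> W \<Longrightarrow> \<phi> c (x + y) = \<phi> c x + \<phi> c y"
    and scale: "\<And>c k x. c \<in> C \<Longrightarrow> x \<in> W \<Longrightarrow> \<phi> c (k *s x) = k * \<phi> c x"
  shows "dim W \<le> dim {w \<in> W. \<forall>c\<in>C. \<phi> c w = 0} + card C"
  using assms(4) assms(2,3) add scale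
proof (induction C arbitrary: W rule: finite_induct)
  case empty
  then show ?case
    by simp
next
  case (insert c C)
  let ?V = "{w \<in> W. \<phi> c w = 0}"
  have "dim W \<le> dim ?V + 1"
    by (rule dim_le_kernel[OF assms(1) insert.prems(1,2)]) (simp_all add: insert.prems(3,4))
  moreover have "dim ?V \<le> dim {w \<in> ?V. \<forall>c\<in>C. \<phi> c w = 0} + card C"
  proof (rule insert.IH)
    show "?V \<subseteq> span B"
      using insert.prems(1) by blast
    show "subspace ?V"
      by (rule subspace_kernel_on[OF insert.prems(2)]) (simp_all add: insert.prems(3,4))
  qed (simp_all add: insert.prems(3,4))
  moreover have "{w \<in> ?V. \<forall>c\<in>C. \<phi> c w = 0} = {w \<in> W. \<forall>c\<in>insert c C. \<phi> c w = 0}"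
    by auto
  ultimately show ?case
    using insert.hyps by simp
qed

text \<open>Greedy choice: take a functional that is nonzero somewhere on the current space, pass to
  its kernel, repeat. Each step costs at most one dimension, so \<open>r\<close> steps are possible,
  and later vectors lie in the kernels of earlier functionals. The triangular shape will make a
  determinant visibly nonzero.\<close>

lemma triangular_family:
  assumes "finite B" "W \<subseteq> span B" "subspace W"
    and add: "\<And>c x y. c \<in> C \<Longrightarrow> x \<in> W \<Longrightarrow> y \<in> W \<Longrightarrow> \<phi> c (x + y) = \<phi> c x + \<phi> c y"
    and scale: "\<And>c k x. c \<in> C \<Longrightarrow> x \<in> W \<Longrightarrow> \<phi> c (k *s x) = k * \<phi> c x"
    and "dim {w \<in> W. \<forall>c\<in>C. \<phi> c w = 0} + r \<le> dim W"
  shows "\<exists>d f. (\<forall>i<r. d i \<in> C \<and> f i \<in> W \<and> \<phi> (d i) (f i) \<noteq> 0) \<and>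
           (\<forall>j<r. \<forall>i<j. \<phi> (d i) (f j) = 0)"
  using assms(2-)
proof (induction r arbitrary: W)
  case 0
  then show ?case
    by simp
next
  case (Suc r)
  have "\<exists>c\<in>C. \<exists>g\<in>W. \<phi> c g \<noteq> 0"
  proof (rule ccontr)
    assume "\<not> ?thesis"
    then have "{w \<in> W. \<forall>c\<in>C. \<phi> c w = 0} = W"
      by auto
    then show False
      using Suc.prems(5) by simp
  qed
  then obtain c g where cg: "c \<in> C" "g \<in> W" "\<phi> c g \<noteq> 0"
    by blast
  let ?V = "{w \<in> W. \<phi> c w = 0}"
  have "dim W \<le> dim ?V + 1"
    by (rule dim_le_kernel[OF assms(1) Suc.prems(1,2)]) (simp_all add: Suc.prems(3,4) cg)
  moreover have "{w \<in> ?V. \<forall>c\<in>C. \<phi> c w = 0} = {w \<in> W. \<forall>c\<in>C. \<phi> c w = 0}"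
    using cg by auto
  ultimately have "dim {w \<in> ?V. \<forall>c\<in>C. \<phi> c w = 0} + r \<le> dim ?V"
    using Suc.prems(5) by simp
  moreover have "subspace ?V"
    by (rule subspace_kernel_on[OF Suc.prems(2)]) (simp_all add: Suc.prems(3,4) cg)
  moreover have "?V \<subseteq> span B"
    using Suc.prems(1) by blast
  ultimately obtain d f where df: "\<forall>i<r. d i \<in> C \<and> f i \<in> ?V \<and> \<phi> (d i) (f i) \<noteq> 0"
      "\<forall>j<r. \<forall>i<j. \<phi> (d i) (f j) = 0"
    using Suc.IH[of ?V] Suc.prems(3,4) by auto
  let ?d = "case_nat c d" and ?f = "case_nat g f"
  have "?d i \<in> C \<and> ?f i \<in> W \<and> \<phi> (?d i) (?f i) \<noteq> 0" if "i < Suc r" for i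
    using that cg df(1) by (cases i) auto
  moreover have "\<phi> (?d i) (?f j) = 0" if "j < Suc r" "i < j" for i j
    using that df by (cases j; cases i) auto
  ultimately show ?case
    by blast
qed

lemma span_image_lessThan:
  assumes "y \<in> span (f ` {..<r::nat})"
  shows "\<exists>u. y = (\<Sum>i<r. u i *s f i)"
  using assms
proof (induction r arbitrary: y)
  case 0
  then show ?case
    by simp
next
  case (Suc r)
  then have "y \<in> span (insert (f r) (f ` {..<r}))"
    by (simp add: lessThan_Suc)
  then obtain k where "y - k *s f r \<in> span (f ` {..<r})"
    by (auto simp: span_breakdown_eq)
  then obtain u where u: "y - k *s f r = (\<Sum>i<r. u i *s f i)"
    using Suc.IH by blast
  have "y = (\<Sum>i<Suc r. (u(r := k)) i *s f i)"
    using u by (simp add: algebra_simps)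
  then show ?case
    by blast
qed

text \<open>A matrix of values with trivial kernel makes the \<open>f j\<close> independent modulo
  the common kernel, so together they enlarge a basis of it by \<open>r\<close> elements.
  \<open>inj\<close> states the trivial kernel without matrices; a nonzero determinant will supply
  it.\<close>

lemma codim_common_kernel_ge:
  assumes "finite B" "W \<subseteq> span B" "subspace W"
    and add: "\<And>c x y. c \<in> C \<Longrightarrow> x \<in> W \<Longrightarrow> y \<in> W \<Longrightarrow> \<phi> c (x + y) = \<phi> c x + \<phi> c y"
    and scale: "\<And>c k x. c \<in> C \<Longrightarrow> x \<in> W \<Longrightarrow> \<phi> c (k *s x) = k * \<phi> c x"
    and d: "\<And>i. i < r \<Longrightarrow> d i \<in> C" and f: "\<And>i. i < r \<Longrightarrow> f i \<in> W"
    and inj: "\<And>u. (\<And>i. i < r \<Longrightarrow> (\<Sum>j<r. u j * \<phi> (d i) (f j)) = 0) \<Longrightarrow> (\<And>j. j < r \<Longrightarrow> u j = 0)"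
  shows "dim {w \<in> W. \<forall>c\<in>C. \<phi> c w = 0} + r \<le> dim W"
proof -
  let ?K = "{w \<in> W. \<forall>c\<in>C. \<phi> c w = 0}"
  have zero: "\<phi> c 0 = 0" if "c \<in> C" for c
    using scale[of c 0 0] that subspace_0[OF assms(3)] by simp
  have K: "subspace ?K"
    using assms(3) by (auto simp: subspace_def add scale zero)
  have sumW: "(\<Sum>j\<in>J. u j *s f j) \<in> W" if "J \<subseteq> {..<r}" for u J
    using that f by (intro subspace_sum[OF assms(3)] subspace_scale[OF assms(3)]) auto
  have phi_sum: "\<phi> c (\<Sum>j\<in>J. u j *s f j) = (\<Sum>j\<in>J. u j * \<phi> c (f j))"
    if "c \<in> C" "J \<subseteq> {..<r}" for c u J
  proof -
    have "finite J"
      using that(2) finite_subset by blast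
    then show ?thesis
      using that(2)
    proof (induction J rule: finite_induct)
      case empty
      then show ?case
        by (simp add: zero that(1))
    next
      case (insert j J)
      then have "\<phi> c (\<Sum>j\<in>insert j J. u j *s f j) = \<phi> c (u j *s f j) + \<phi> c (\<Sum>j\<in>J. u j *s f j)"
        using add[OF that(1)] sumW[of J u] subspace_scale[OF assms(3) f[of j]] by simp
      then show ?case
        using insert scale[OF that(1) f[of j]] by simp
    qed
  qed
  obtain b where b: "b \<subseteq> ?K" "independent b" "?K \<subseteq> span b" "card b = dim ?K"
    by (rule basis_exists)
  have "finite b"
    using independent_span_bound[OF assms(1) b(2)] b(1) assms(2) by blast
  have spb: "span b \<subseteq> ?K"
    by (rule span_minimal[OF b(1) K])
  have notin: "f m \<notin> span (b \<union> f ` {..<m})" if m: "m < r" for m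
  proof
    assume "f m \<in> span (b \<union> f ` {..<m})"
    then obtain x y where xy: "f m = x + y" "x \<in> span b" "y \<in> span (f ` {..<m})"
      by (auto simp: span_Un)
    from span_image_lessThan[OF xy(3)] obtain u where u: "y = (\<Sum>i<m. u i *s f i)"
      by blast
    \<comment> \<open>The coefficients of \<open>f m - y\<close>, which equals \<open>x\<close> and
      is therefore killed by every functional; the entry 1 at \<open>m\<close> contradicts
      \<open>inj\<close>.\<close>
    let ?u = "\<lambda>i. if i = m then 1 else if i < m then - u i else 0"
    have x: "x \<in> ?K"
      using xy(2) spb by blast
    have "(\<Sum>j<r. ?u j * \<phi> (d i) (f j)) = 0" if i: "i < r" for i
    proof -
      have "(\<Sum>j<r. ?u j * \<phi> (d i) (f j)) = (\<Sum>j<Suc m. ?u j * \<phi> (d i) (f j))"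
        using m by (intro sum.mono_neutral_right) auto
      also have "\<dots> = \<phi> (d i) (f m) - (\<Sum>j<m. u j * \<phi> (d i) (f j))"
        by (simp add: sum_negf)
      also have "(\<Sum>j<m. u j * \<phi> (d i) (f j)) = \<phi> (d i) y"
        unfolding u using m by (intro phi_sum[symmetric] d i) auto
      also have "\<phi> (d i) (f m) = \<phi> (d i) x + \<phi> (d i) y"
        unfolding xy(1) using x sumW[of "{..<m}" u] m u by (intro add d i) auto
      also have "\<phi> (d i) x = 0"
        using x d i by blast
      finally show ?thesis
        by simp
    qed
    from inj[of ?u m, OF this m] show False
      by simp
  qed
  have "independent (b \<union> f ` {..<m}) \<and> card (b \<union> f ` {..<m}) = card b + m" if "m \<le> r" for m
    using that
  proof (induction m)
    case 0
    then show ?case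
      using b(2) by simp
  next
    case (Suc m)
    have eq: "b \<union> f ` {..<Suc m} = insert (f m) (b \<union> f ` {..<m})"
      by (auto simp: lessThan_Suc)
    have "f m \<notin> b \<union> f ` {..<m}"
      using notin[of m] Suc.prems span_base by (metis Suc_le_eq)
    then show ?case
      unfolding eq using Suc notin[of m] \<open>finite b\<close> by (simp add: independent_insertI)
  qed
  then have ind: "independent (b \<union> f ` {..<r})" "card (b \<union> f ` {..<r}) = card b + r"
    by blast+
  obtain w where w: "w \<subseteq> W" "independent w" "W \<subseteq> span w" "card w = dim W"
    by (rule basis_exists)
  have "finite w"
    using independent_span_bound[OF assms(1) w(2)] w(1) assms(2) by blast
  moreover have "b \<union> f ` {..<r} \<subseteq> span w"
    using b(1) f w(3) by auto
  ultimately show ?thesis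
    using independent_span_bound[of w "b \<union> f ` {..<r}"] ind b(4) w(4) by simp
qed

end

section \<open>Homomorphisms from polynomial rings and derivatives\<close>

definition mvar :: "'v \<Rightarrow> 'v cpoly" where
  "mvar v = Poly_Mapping.single (Poly_Mapping.single v 1) 1"

definition cst :: "complex \<Rightarrow> 'v cpoly" where
  "cst c = Poly_Mapping.single 0 c"

definition unit_fun :: "'v \<Rightarrow> 'v \<Rightarrow> complex" where
  "unit_fun w = (\<lambda>u. if u = w then 1 else 0)"

definition monom_eval :: "('v \<Rightarrow> 'r::comm_ring_1) \<Rightarrow> ('v \<Rightarrow>\<^sub>0 nat) \<Rightarrow> 'r" where
  "monom_eval s m = (\<Prod>v\<in>Poly_Mapping.keys m. s v ^ Poly_Mapping.lookup m v)"

text \<open>The coefficient map \<open>h\<close> and the target ring are left open so that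
  evaluation at a point, substitution of polynomials, restriction to a line and formal
  differentiation are all instances and share one homomorphism proof.\<close>

definition peval :: "(complex \<Rightarrow> 'r::comm_ring_1) \<Rightarrow> ('v \<Rightarrow> 'r) \<Rightarrow> 'v cpoly \<Rightarrow> 'r" where
  "peval h s f = (\<Sum>m\<in>Poly_Mapping.keys f. h (Poly_Mapping.lookup f m) * monom_eval s m)"

lemma monom_eval_superset:
  assumes "finite A" "Poly_Mapping.keys m \<subseteq> A"
  shows "monom_eval s m = (\<Prod>v\<in>A. s v ^ Poly_Mapping.lookup m v)"
  unfolding monom_eval_def using assms
  by (intro prod.mono_neutral_left) (auto simp: in_keys_iff)

lemma monom_eval_0 [simp]: "monom_eval s 0 = 1"
  by (simp add: monom_eval_def)

lemma monom_eval_single [simp]: "monom_eval s (Poly_Mapping.single v k) = s v ^ k"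
  by (simp add: monom_eval_def)

lemma monom_eval_add: "monom_eval s (m + m') = monom_eval s m * monom_eval s m'"
proof -
  let ?A = "Poly_Mapping.keys m \<union> Poly_Mapping.keys m'"
  have "monom_eval s (m + m') = (\<Prod>v\<in>?A. s v ^ Poly_Mapping.lookup (m + m') v)"
    by (rule monom_eval_superset) (auto dest: subsetD[OF Poly_Mapping.keys_add])
  also have "\<dots> = (\<Prod>v\<in>?A. s v ^ Poly_Mapping.lookup m v) * (\<Prod>v\<in>?A. s v ^ Poly_Mapping.lookup m' v)"
    by (simp add: lookup_add power_add prod.distrib)
  also have "\<dots> = monom_eval s m * monom_eval s m'"
    by (simp add: monom_eval_superset[of ?A])
  finally show ?thesis .
qed

lemma poly_mapping_sum_single:
  fixes f :: "'a \<Rightarrow>\<^sub>0 'b::comm_monoid_add"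
  shows "f = (\<Sum>m\<in>Poly_Mapping.keys f. Poly_Mapping.single m (Poly_Mapping.lookup f m))"
  by (rule poly_mapping_eqI) (simp add: lookup_sum lookup_single when_def in_keys_iff sum.delta')

lemma single_add_induct [case_names zero single add]:
  fixes f :: "'a \<Rightarrow>\<^sub>0 'b::comm_monoid_add"
  assumes "P 0" "\<And>m c. P (Poly_Mapping.single m c)" "\<And>f g. P f \<Longrightarrow> P g \<Longrightarrow> P (f + g)"
  shows "P f"
proof -
  have "P (\<Sum>m\<in>A. Poly_Mapping.single m (Poly_Mapping.lookup f m))" if "finite A" for A
    using that by (induction A rule: finite_induct) (simp_all add: assms)
  from this[OF finite_keys, of f] show ?thesis
    by (simp add: poly_mapping_sum_single[symmetric])
qed

lemma exponent_induct [case_names zero add]: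
  fixes m :: "'v \<Rightarrow>\<^sub>0 nat"
  assumes zero: "P 0" and add: "\<And>v m. P m \<Longrightarrow> P (Poly_Mapping.single v 1 + m)"
  shows "P m"
proof -
  have step: "P (Poly_Mapping.single v k + m)" if "P m" for v k and m :: "'v \<Rightarrow>\<^sub>0 nat"
  proof (induction k)
    case 0
    then show ?case
      by (simp add: that)
  next
    case (Suc k)
    have "Poly_Mapping.single v (Suc k) = Poly_Mapping.single v 1 + Poly_Mapping.single v k"
      by (simp add: single_add[symmetric])
    then show ?case
      using add[OF Suc, of v] by (simp add: add.assoc)
  qed
  \<comment> \<open>\<open>P\<close> itself need not pass to sums of exponents; this generalization
    over \<open>m'\<close> does, as an induction over sums of singles requires.\<close>
  have "\<forall>m'. P m' \<longrightarrow> P (m + m')" for m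
    by (induction m rule: single_add_induct) (simp_all add: step add.assoc)
  from this[of m] show ?thesis
    using zero by (metis add_0_right)
qed

lemma single_add_exponent:
  "Poly_Mapping.single (Poly_Mapping.single v 1 + m) c = mvar v * Poly_Mapping.single m c"
  by (simp add: mvar_def mult_single)

lemma cpoly_induct [case_names cst mvar add mult]:
  assumes cst: "\<And>c. P (cst c)" and var: "\<And>v. P (mvar v)"
    and add: "\<And>f g. P f \<Longrightarrow> P g \<Longrightarrow> P (f + g)" and mult: "\<And>f g. P f \<Longrightarrow> P g \<Longrightarrow> P (f * g)"
  shows "P f"
proof (induction f rule: single_add_induct)
  case zero
  show ?case
    using cst[of 0] by (simp add: cst_def)
next
  case (single m c)
  show ?case
  proof (induction m rule: exponent_induct)
    case zero
    show ?case
      using cst[of c] by (simp add: cst_def)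
  next
    case (add v m)
    then show ?case
      unfolding single_add_exponent by (intro mult var)
  qed
qed (rule add)

lemma cst_hom: "comm_ring_hom cst"
  by unfold_locales (simp_all add: cst_def single_add mult_single)

lemma poly_scale_eq: "poly_scale c f = cst c * f"
  by (simp add: poly_scale_def cst_def mult_map_scale_conv_mult)

lemma id_hom: "comm_ring_hom (\<lambda>c. c)"
  by unfold_locales simp_all

lemma pCons_hom: "comm_ring_hom h \<Longrightarrow> comm_ring_hom (\<lambda>c. [:h c:])"
proof -
  assume "comm_ring_hom h"
  then interpret comm_ring_hom h .
  show ?thesis
    by unfold_locales (simp_all add: hom_distribs one_pCons)
qed

lemma peval_superset:
  assumes "comm_ring_hom h" "finite A" "Poly_Mapping.keys f \<subseteq> A"
  shows "peval h s f = (\<Sum>m\<in>A. h (Poly_Mapping.lookup f m) * monom_eval s m)"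
proof -
  interpret comm_ring_hom h by fact
  show ?thesis
    unfolding peval_def using assms(2,3)
    by (intro sum.mono_neutral_left) (auto simp: in_keys_iff)
qed

lemma peval_single:
  assumes "comm_ring_hom h"
  shows "peval h s (Poly_Mapping.single m c) = h c * monom_eval s m"
proof -
  interpret comm_ring_hom h by fact
  show ?thesis
    by (simp add: peval_superset[OF assms, of "{m}"])
qed

lemma peval_add:
  assumes "comm_ring_hom h"
  shows "peval h s (f + g) = peval h s f + peval h s g"
proof -
  interpret comm_ring_hom h by fact
  let ?A = "Poly_Mapping.keys f \<union> Poly_Mapping.keys g"
  have "peval h s (f + g) = (\<Sum>m\<in>?A. h (Poly_Mapping.lookup (f + g) m) * monom_eval s m)"
    by (rule peval_superset[OF assms]) (auto dest: subsetD[OF Poly_Mapping.keys_add])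
  then show ?thesis
    by (simp add: peval_superset[OF assms, of ?A] lookup_add hom_add algebra_simps sum.distrib)
qed

lemma peval_mult:
  assumes "comm_ring_hom h"
  shows "peval h s (f * g) = peval h s f * peval h s g"
proof -
  interpret comm_ring_hom h by fact
  have zero: "peval h s 0 = 0"
    by (simp add: peval_def)
  have single: "peval h s (Poly_Mapping.single m c * g) = peval h s (Poly_Mapping.single m c) * peval h s g"
    for m c
    by (induction g rule: single_add_induct)
      (simp_all add: zero mult_single peval_single[OF assms] monom_eval_add hom_mult
        distrib_left peval_add[OF assms])
  show ?thesis
    by (induction f rule: single_add_induct)
      (simp_all add: zero single distrib_right peval_add[OF assms])
qed

lemma peval_cst: "comm_ring_hom h \<Longrightarrow> peval h s (cst c) = h c"
  by (simp add: cst_def peval_single)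

lemma peval_mvar: "comm_ring_hom h \<Longrightarrow> peval h s (mvar v) = s v"
proof -
  assume h: "comm_ring_hom h"
  then interpret comm_ring_hom h .
  show ?thesis
    by (simp add: mvar_def peval_single[OF h])
qed

lemma peval_hom:
  assumes "comm_ring_hom h"
  shows "comm_ring_hom (peval h s)"
proof -
  interpret comm_ring_hom h by fact
  show ?thesis
    using peval_cst[OF assms, of s 1]
    by unfold_locales
      (simp_all add: peval_add[OF assms] peval_mult[OF assms] peval_def[of h s 0] cst_def)
qed

lemma peval_cong:
  assumes "\<And>m v. m \<in> Poly_Mapping.keys f \<Longrightarrow> v \<in> Poly_Mapping.keys m \<Longrightarrow> s v = s' v"
  shows "peval h s f = peval h s' f"
  unfolding peval_def monom_eval_def using assms by (intro sum.cong prod.cong refl arg_cong2[of _ _ _ _ "(*)"]) auto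

lemma poly_eval_eq_peval: "poly_eval x f = peval (\<lambda>c. c) x f"
  by (simp add: poly_eval_def peval_def monom_eval_def)

interpretation poly_eval_hom: comm_ring_hom "poly_eval x"
  unfolding poly_eval_eq_peval[abs_def] by (rule peval_hom[OF id_hom])

lemma poly_eval_cst [simp]: "poly_eval x (cst c) = c"
  by (simp add: poly_eval_eq_peval peval_cst[OF id_hom])

lemma poly_eval_mvar [simp]: "poly_eval x (mvar v) = x v"
  by (simp add: poly_eval_eq_peval peval_mvar[OF id_hom])

definition poly_subst :: "('v \<Rightarrow> 'w cpoly) \<Rightarrow> 'v cpoly \<Rightarrow> 'w cpoly" where
  "poly_subst = peval cst"

interpretation poly_subst_hom: comm_ring_hom "poly_subst s"
  unfolding poly_subst_def by (rule peval_hom[OF cst_hom])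

lemma poly_subst_cst [simp]: "poly_subst s (cst c) = cst c"
  by (simp add: poly_subst_def peval_cst[OF cst_hom])

lemma poly_subst_mvar [simp]: "poly_subst s (mvar v) = s v"
  by (simp add: poly_subst_def peval_mvar[OF cst_hom])

section \<open>Restriction to lines and derivatives\<close>

definition on_line :: "('v \<Rightarrow> complex) \<Rightarrow> ('v \<Rightarrow> complex) \<Rightarrow> 'v cpoly \<Rightarrow> complex poly" where
  "on_line x v = peval (\<lambda>c. [:c:]) (\<lambda>w. [:x w, v w:])"

text \<open>The coefficient of \<open>t\<close> in \<open>f (x + t v)\<close>. The Leibniz rule thus
  becomes the formula for the linear coefficient of a product, and a polynomial vanishing along a
  line has zero derivative there without any limit.\<close>

definition dir_deriv :: "('v \<Rightarrow> complex) \<Rightarrow> ('v \<Rightarrow> complex) \<Rightarrow> 'v cpoly \<Rightarrow> complex" where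
  "dir_deriv x v f = coeff (on_line x v f) 1"

interpretation on_line_hom: comm_ring_hom "on_line x v"
  unfolding on_line_def by (rule peval_hom[OF pCons_hom[OF id_hom]])

lemma on_line_cst [simp]: "on_line x v (cst c) = [:c:]"
  by (simp add: on_line_def peval_cst[OF pCons_hom[OF id_hom]])

lemma on_line_mvar [simp]: "on_line x v (mvar w) = [:x w, v w:]"
  by (simp add: on_line_def peval_mvar[OF pCons_hom[OF id_hom]])

lemma poly_on_line: "poly (on_line x v f) t = poly_eval (\<lambda>w. x w + t * v w) f"
  by (induction f rule: cpoly_induct)
    (simp_all add: on_line_hom.hom_add on_line_hom.hom_mult poly_eval_hom.hom_add poly_eval_hom.hom_mult)

lemma coeff_0_on_line: "coeff (on_line x v f) 0 = poly_eval x f"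
  using poly_on_line[of x v f 0] by (simp add: poly_0_coeff_0)

lemma coeff_1_mult: "coeff (p * q) 1 = coeff p 0 * coeff q 1 + coeff p 1 * coeff q 0"
  by (simp add: coeff_mult)

lemma dir_deriv_cst [simp]: "dir_deriv x v (cst c) = 0"
  by (simp add: dir_deriv_def)

lemma dir_deriv_0 [simp]: "dir_deriv x v 0 = 0"
  by (simp add: dir_deriv_def)

lemma dir_deriv_mvar [simp]: "dir_deriv x v (mvar w) = v w"
  by (simp add: dir_deriv_def)

lemma dir_deriv_add: "dir_deriv x v (f + g) = dir_deriv x v f + dir_deriv x v g"
  by (simp add: dir_deriv_def on_line_hom.hom_add)

lemma dir_deriv_mult:
  "dir_deriv x v (f * g) = poly_eval x f * dir_deriv x v g + dir_deriv x v f * poly_eval x g"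
  by (simp only: dir_deriv_def on_line_hom.hom_mult coeff_1_mult coeff_0_on_line)

lemma poly_eval_subst:
  "poly_eval x (poly_subst s f) = poly_eval (\<lambda>w. poly_eval x (s w)) f"
  by (induction f rule: cpoly_induct)
    (simp_all add: poly_subst_hom.hom_add poly_subst_hom.hom_mult poly_eval_hom.hom_add poly_eval_hom.hom_mult)

lemma dir_deriv_subst:
  "dir_deriv x v (poly_subst s f) = dir_deriv (\<lambda>w. poly_eval x (s w)) (\<lambda>w. dir_deriv x v (s w)) f"
  by (induction f rule: cpoly_induct)
    (simp_all add: poly_subst_hom.hom_add poly_subst_hom.hom_mult dir_deriv_add dir_deriv_mult poly_eval_subst)

text \<open>Substitutes \<open>mvar w + t\<close> for \<open>mvar w\<close>: the constant
  coefficient is \<open>f\<close>, the linear one its partial derivative. In contrast to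
  \<open>dir_deriv\<close> this yields a polynomial in the point, which has a multidegree and can be
  an entry of a minor.\<close>

definition deriv_pair :: "'v \<Rightarrow> 'v cpoly \<Rightarrow> 'v cpoly poly" where
  "deriv_pair w = peval (\<lambda>c. [:cst c:]) (\<lambda>u. [:mvar u, if u = w then 1 else 0:])"

definition partial_deriv :: "'v \<Rightarrow> 'v cpoly \<Rightarrow> 'v cpoly" where
  "partial_deriv w f = coeff (deriv_pair w f) 1"

interpretation deriv_pair_hom: comm_ring_hom "deriv_pair w"
  unfolding deriv_pair_def by (rule peval_hom[OF pCons_hom[OF cst_hom]])

lemma deriv_pair_cst [simp]: "deriv_pair w (cst c) = [:cst c:]"
  by (simp add: deriv_pair_def peval_cst[OF pCons_hom[OF cst_hom]])

lemma deriv_pair_mvar [simp]: "deriv_pair w (mvar u) = [:mvar u, if u = w then 1 else 0:]"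
  by (simp add: deriv_pair_def peval_mvar[OF pCons_hom[OF cst_hom]])

lemma coeff_0_deriv_pair: "coeff (deriv_pair w f) 0 = f"
  by (induction f rule: cpoly_induct)
    (simp_all add: deriv_pair_hom.hom_add deriv_pair_hom.hom_mult coeff_mult_0)

lemma partial_deriv_cst [simp]: "partial_deriv w (cst c) = 0"
  by (simp add: partial_deriv_def)

lemma partial_deriv_0 [simp]: "partial_deriv w 0 = 0"
  by (simp add: partial_deriv_def)

lemma partial_deriv_mvar [simp]: "partial_deriv w (mvar u) = (if u = w then 1 else 0)"
  by (simp add: partial_deriv_def)

lemma partial_deriv_add: "partial_deriv w (f + g) = partial_deriv w f + partial_deriv w g"
  by (simp add: partial_deriv_def deriv_pair_hom.hom_add)

lemma partial_deriv_mult: "partial_deriv w (f * g) = f * partial_deriv w g + partial_deriv w f * g"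
  by (simp only: partial_deriv_def deriv_pair_hom.hom_mult coeff_1_mult coeff_0_deriv_pair)

lemma poly_eval_partial_deriv: "poly_eval x (partial_deriv w f) = dir_deriv x (unit_fun w) f"
  by (induction f rule: cpoly_induct)
    (simp_all add: partial_deriv_add partial_deriv_mult dir_deriv_add dir_deriv_mult unit_fun_def
      poly_eval_hom.hom_add poly_eval_hom.hom_mult)

section \<open>The coordinate ring and its multihomogeneous forms\<close>

lemma carrier_coord_ring:
  "f \<in> carrier (coord_ring I n) \<longleftrightarrow>
     (\<forall>m\<in>Poly_Mapping.keys f. Poly_Mapping.keys m \<subseteq> coord_vars I n)"
  by (simp add: coord_ring_def)

lemma coord_ring_simps [simp]:
  "monoid.mult (coord_ring I n) = (*)" "one (coord_ring I n) = 1" "zero (coord_ring I n) = 0"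
  "add (coord_ring I n) = (+)"
  by (simp_all add: coord_ring_def)

lemma poly_eval_cong:
  assumes "f \<in> carrier (coord_ring I n)" "\<And>v. v \<in> coord_vars I n \<Longrightarrow> x v = y v"
  shows "poly_eval x f = poly_eval y f"
  unfolding poly_eval_eq_peval using assms by (intro peval_cong) (auto simp: carrier_coord_ring)

lemma coord_vars_iff: "(i, j) \<in> coord_vars I n \<longleftrightarrow> i \<in> I \<and> j \<le> n i"
  by (simp add: coord_vars_def)

lemma carrier_add: "f \<in> carrier (coord_ring I n) \<Longrightarrow> g \<in> carrier (coord_ring I n) \<Longrightarrow>
    f + g \<in> carrier (coord_ring I n)"
proof -
  interpret cring "coord_ring I n" by (rule cring_coord_ring)
  show "f \<in> carrier (coord_ring I n) \<Longrightarrow> g \<in> carrier (coord_ring I n) \<Longrightarrow> ?thesis"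
    using a_closed[of f g] by simp
qed

lemma carrier_mult: "f \<in> carrier (coord_ring I n) \<Longrightarrow> g \<in> carrier (coord_ring I n) \<Longrightarrow>
    f * g \<in> carrier (coord_ring I n)"
proof -
  interpret cring "coord_ring I n" by (rule cring_coord_ring)
  show "f \<in> carrier (coord_ring I n) \<Longrightarrow> g \<in> carrier (coord_ring I n) \<Longrightarrow> ?thesis"
    using m_closed[of f g] by simp
qed

lemma carrier_cst: "cst c \<in> carrier (coord_ring I n)"
  by (simp add: carrier_coord_ring cst_def)

lemma carrier_0: "0 \<in> carrier (coord_ring I n)" and carrier_1: "1 \<in> carrier (coord_ring I n)"
  by (simp_all add: carrier_coord_ring)

lemma carrier_mvar: "mvar v \<in> carrier (coord_ring I n) \<longleftrightarrow> v \<in> coord_vars I n"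
  by (simp add: carrier_coord_ring mvar_def)

lemma forms_carrier: "f \<in> forms I n d \<Longrightarrow> f \<in> carrier (coord_ring I n)"
  by (simp add: forms_def)

lemma forms_0: "0 \<in> forms I n d"
  by (simp add: forms_def carrier_0)

lemma forms_add:
  assumes "f \<in> forms I n d" "g \<in> forms I n d"
  shows "f + g \<in> forms I n d"
  using assms carrier_add Poly_Mapping.keys_add[of f g] by (fastforce simp: forms_def)

lemma forms_sum: "(\<And>x. x \<in> A \<Longrightarrow> f x \<in> forms I n d) \<Longrightarrow> sum f A \<in> forms I n d"
  by (induction A rule: infinite_finite_induct) (simp_all add: forms_0 forms_add)

lemma forms_cong: "(\<And>i. i \<in> I \<Longrightarrow> d i = e i) \<Longrightarrow> forms I n d = forms I n e"
  by (auto simp: forms_def)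

lemma forms_mult:
  assumes "f \<in> forms I n d" "g \<in> forms I n e"
  shows "f * g \<in> forms I n (\<lambda>i. d i + e i)"
proof -
  have "\<exists>a b. m = a + b \<and> a \<in> Poly_Mapping.keys f \<and> b \<in> Poly_Mapping.keys g"
    if "m \<in> Poly_Mapping.keys (f * g)" for m
    using subsetD[OF keys_mult that] by blast
  then show ?thesis
    using assms by (fastforce simp: forms_def carrier_mult lookup_add sum.distrib)
qed

lemma forms_cst: "(\<And>i. i \<in> I \<Longrightarrow> d i = 0) \<Longrightarrow> cst c \<in> forms I n d"
  by (simp add: forms_def carrier_cst) (simp add: cst_def)

lemma forms_1: "1 \<in> forms I n (\<lambda>i. 0)"
  using forms_cst[of I "\<lambda>i. 0" 1 n] by (simp add: cst_def)

lemma forms_scale: "f \<in> forms I n d \<Longrightarrow> cst c * f \<in> forms I n d"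
  using forms_mult[OF forms_cst[of I "\<lambda>i. 0" c n], of f d] by simp

lemma sum_lookup_single:
  fixes n :: "'i \<Rightarrow> nat"
  assumes "j \<le> n i"
  shows "(\<Sum>j'\<le>n i'. Poly_Mapping.lookup (Poly_Mapping.single (i, j) k) (i', j')) = (if i' = i then k else (0::nat))"
proof -
  have "(\<Sum>j'\<le>n i'. Poly_Mapping.lookup (Poly_Mapping.single (i, j) k) (i', j')) =
      (\<Sum>j'\<in>{..n i'}. if j' = j then (if i' = i then k else 0) else 0)"
    by (intro sum.cong) (auto simp: lookup_single when_def)
  also have "\<dots> = (if i' = i then k else 0)"
    using assms by (subst sum.delta) auto
  finally show ?thesis .
qed

lemma forms_mvar:
  assumes "(i, j) \<in> coord_vars I n"
  shows "mvar (i, j) \<in> forms I n (\<lambda>i'. if i' = i then 1 else 0)"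
proof -
  have "j \<le> n i"
    using assms by (simp add: coord_vars_iff)
  then have "(\<Sum>j'\<le>n i'. Poly_Mapping.lookup (Poly_Mapping.single (i, j) 1) (i', j')) = (if i' = i then 1 else (0::nat))" for i'
    by (rule sum_lookup_single)
  then show ?thesis
    using assms by (simp add: forms_def carrier_mvar) (auto simp: mvar_def lookup_single when_def coord_vars_iff)
qed

text \<open>Monomials are taken apart one variable at a time, while sums stay within one degree.
  Since every variable raises the multidegree, \<open>P\<close> has the degree as an
  argument.\<close>

lemma forms_induct [consumes 1, case_names zero add cst mvar]:
  assumes "f \<in> forms I n d"
    and zero: "\<And>d. P d 0"
    and add: "\<And>d f g. f \<in> forms I n d \<Longrightarrow> g \<in> forms I n d \<Longrightarrow> P d f \<Longrightarrow> P d g \<Longrightarrow> P d (f + g)"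
    and cst: "\<And>d c. (\<And>i. i \<in> I \<Longrightarrow> d i = 0) \<Longrightarrow> P d (cst c)"
    and var: "\<And>d f i j. f \<in> forms I n d \<Longrightarrow> P d f \<Longrightarrow> i \<in> I \<Longrightarrow> j \<le> n i \<Longrightarrow>
                P (d(i := Suc (d i))) (mvar (i, j) * f)"
  shows "P d f"
proof -
  have single: "Poly_Mapping.single m c \<in> forms I n d \<Longrightarrow> P d (Poly_Mapping.single m c)" for m c d
  proof (induction m arbitrary: d rule: exponent_induct)
    case zero
    then show ?case
      using cst[of d c] assms(2)[of d] by (cases "c = 0") (auto simp: forms_def cst_def)
  next
    case (add v m)
    obtain i j where v: "v = (i, j)"
      by (cases v)
    show ?case
    proof (cases "c = 0")
      case True
      then show ?thesis
        by (simp add: zero)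
    next
      case False
      then have vars: "Poly_Mapping.keys (Poly_Mapping.single v 1 + m) \<subseteq> coord_vars I n"
        and deg: "\<And>i'. i' \<in> I \<Longrightarrow>
          (\<Sum>j'\<le>n i'. Poly_Mapping.lookup (Poly_Mapping.single v 1 + m) (i', j')) = d i'"
        using add.prems by (auto simp: forms_def carrier_coord_ring)
      have "v \<in> Poly_Mapping.keys (Poly_Mapping.single v 1 + m)"
        by (simp add: in_keys_iff lookup_add)
      then have ij: "i \<in> I" "j \<le> n i"
        using vars by (auto simp: v coord_vars_iff)
      have keys: "Poly_Mapping.keys m \<subseteq> coord_vars I n"
        using vars by (auto simp: in_keys_iff lookup_add)
      have deg': "(if i' = i then 1 else 0) + (\<Sum>j'\<le>n i'. Poly_Mapping.lookup m (i', j')) = d i'"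
        if "i' \<in> I" for i'
        using deg[OF that] sum_lookup_single[where i = i and i' = i' and j = j and n = n and k = 1] ij
        by (simp add: v lookup_add sum.distrib)
      \<comment> \<open>The subtraction is exact: \<open>deg'\<close> at \<open>i\<close> shows that
        \<open>d i\<close> is positive.\<close>
      define e where "e = d(i := d i - 1)"
      have "Poly_Mapping.single m c \<in> forms I n e"
        using keys deg' False by (force simp: forms_def carrier_coord_ring e_def)
      then have "P (e(i := Suc (e i))) (mvar v * Poly_Mapping.single m c)"
        unfolding v using add.IH[of e] ij by (intro var) auto
      moreover have "e(i := Suc (e i)) = d"
        using deg'[OF ij(1)] by (auto simp: e_def)
      ultimately show ?thesis
        unfolding single_add_exponent by simp
    qed
  qed
  have "(\<Sum>m\<in>A. Poly_Mapping.single m (Poly_Mapping.lookup f m)) \<in> forms I n d \<and>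
      P d (\<Sum>m\<in>A. Poly_Mapping.single m (Poly_Mapping.lookup f m))"
    if "finite A" "A \<subseteq> Poly_Mapping.keys f" for A
    using that
  proof (induction A rule: finite_induct)
    case empty
    then show ?case
      by (simp add: forms_0 zero)
  next
    case (insert m A)
    have "Poly_Mapping.single m (Poly_Mapping.lookup f m) \<in> forms I n d"
      using insert.prems assms(1) by (auto simp: forms_def carrier_coord_ring)
    then show ?case
      using insert by (simp add: forms_add add single)
  qed
  from this[OF finite_keys subset_refl] show ?thesis
    by (simp add: poly_mapping_sum_single[symmetric])
qed

section \<open>Spaces of multihomogeneous forms\<close>

interpretation cpoly: vector_space "poly_scale :: complex \<Rightarrow> 'v cpoly \<Rightarrow> 'v cpoly"
  by (rule vector_space_poly_scale)

lemma subspace_forms: "cpoly.subspace (forms I n d)"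
  unfolding cpoly.subspace_def by (simp add: forms_0 forms_add poly_scale_eq forms_scale)

definition form_exponents :: "'i set \<Rightarrow> ('i \<Rightarrow> nat) \<Rightarrow> ('i \<Rightarrow> nat) \<Rightarrow> ('i \<times> nat \<Rightarrow>\<^sub>0 nat) set" where
  "form_exponents I n d = {m. Poly_Mapping.keys m \<subseteq> coord_vars I n \<and>
     (\<forall>i\<in>I. (\<Sum>j\<le>n i. Poly_Mapping.lookup m (i, j)) = d i)}"

lemma forms_iff: "f \<in> forms I n d \<longleftrightarrow> Poly_Mapping.keys f \<subseteq> form_exponents I n d"
  by (auto simp: forms_def form_exponents_def carrier_coord_ring)

text \<open>Stars and bars in each factor: an exponent of multidegree \<open>d\<close> is a family
  of lists of length \<open>n i + 1\<close> with sum \<open>d i\<close>.\<close>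

lemma card_form_exponents:
  fixes I :: "'a set"
  assumes "finite I"
  shows "finite (form_exponents I n d)"
    and "card (form_exponents I n d) = (\<Prod>i\<in>I. (n i + d i) choose (d i))"
proof -
  let ?L = "\<lambda>i. {l::nat list. length l = Suc (n i) \<and> sum_list l = d i}"
  let ?enc = "\<lambda>m. \<lambda>i\<in>I. map (\<lambda>j. Poly_Mapping.lookup m (i, j)) [0..<Suc (n i)]"
  let ?dec = "\<lambda>g. Abs_poly_mapping (\<lambda>(i, j). if i \<in> I \<and> j \<le> n i then g i ! j else 0)"
  have fin: "finite {w. (\<lambda>(i, j). if i \<in> I \<and> j \<le> n i then g i ! j else 0) w \<noteq> (0::nat)}" for g :: "'a \<Rightarrow> nat list"
  proof (rule finite_subset)
    show "finite (SIGMA i:I. {..n i})"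
      using assms by simp
  qed (auto split: if_splits)
  have lookup_dec: "Poly_Mapping.lookup (?dec g) (i, j) = (if i \<in> I \<and> j \<le> n i then g i ! j else 0)"
    for g :: "'a \<Rightarrow> nat list" and i j
    using fin[of g] by (subst Abs_poly_mapping_inverse) auto
  have sum_nth: "(\<Sum>j\<le>n i. l ! j) = sum_list l" if "length l = Suc (n i)" for l :: "nat list" and i
    using that by (simp add: sum_list_sum_nth atMost_atLeast0 atLeastLessThanSuc_atLeastAtMost)
  have bij: "bij_betw ?enc (form_exponents I n d) (\<Pi>\<^sub>E i\<in>I. ?L i)"
  proof (rule bij_betw_byWitness[where f' = ?dec])
    show "\<forall>m\<in>form_exponents I n d. ?dec (?enc m) = m"
    proof (intro ballI poly_mapping_eqI)
      fix m and w :: "'a \<times> nat" assume m: "m \<in> form_exponents I n d"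
      obtain i j where w: "w = (i, j)"
        by (cases w)
      have "Poly_Mapping.lookup m (i, j) = 0" if "\<not> (i \<in> I \<and> j \<le> n i)"
        using m that by (auto simp: form_exponents_def coord_vars_def in_keys_iff)
      then show "Poly_Mapping.lookup (?dec (?enc m)) w = Poly_Mapping.lookup m w"
        unfolding w lookup_dec by (auto simp del: upt_Suc)
    qed
    show "\<forall>g\<in>\<Pi>\<^sub>E i\<in>I. ?L i. ?enc (?dec g) = g"
    proof
      fix g assume g: "g \<in> (\<Pi>\<^sub>E i\<in>I. ?L i)"
      show "?enc (?dec g) = g"
      proof
        fix i
        show "?enc (?dec g) i = g i"
        proof (cases "i \<in> I")
          case True
          with g have "length (g i) = Suc (n i)"
            by (auto simp: PiE_def Pi_def)
          then show ?thesis
            using True by (intro nth_equalityI) (simp_all add: lookup_dec del: upt_Suc)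
        next
          case False
          then show ?thesis
            using g by (auto simp: PiE_def extensional_def)
        qed
      qed
    qed
    show "?enc ` form_exponents I n d \<subseteq> (\<Pi>\<^sub>E i\<in>I. ?L i)"
    proof (intro image_subsetI PiE_I)
      fix m i assume "m \<in> form_exponents I n d" "i \<in> I"
      then have "(\<Sum>j\<le>n i. Poly_Mapping.lookup m (i, j)) = d i"
        by (simp add: form_exponents_def)
      moreover have "sum_list (?enc m i) = (\<Sum>j\<le>n i. ?enc m i ! j)"
        using \<open>i \<in> I\<close> by (intro sum_nth[symmetric]) simp
      ultimately show "?enc m i \<in> ?L i"
        using \<open>i \<in> I\<close> by (simp del: upt_Suc)
    qed simp
    show "?dec ` (\<Pi>\<^sub>E i\<in>I. ?L i) \<subseteq> form_exponents I n d"
    proof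
      fix m assume "m \<in> ?dec ` (\<Pi>\<^sub>E i\<in>I. ?L i)"
      then obtain g where g: "g \<in> (\<Pi>\<^sub>E i\<in>I. ?L i)" and m: "m = ?dec g"
        by blast
      have "Poly_Mapping.keys m \<subseteq> coord_vars I n"
        unfolding m by (auto simp: in_keys_iff lookup_dec coord_vars_iff split: if_splits)
      moreover have "(\<Sum>j\<le>n i. Poly_Mapping.lookup m (i, j)) = d i" if "i \<in> I" for i
      proof -
        have "(\<Sum>j\<le>n i. Poly_Mapping.lookup m (i, j)) = (\<Sum>j\<le>n i. g i ! j)"
          unfolding m using that by (intro sum.cong) (simp_all add: lookup_dec)
        then show ?thesis
          using g that by (auto simp: sum_nth PiE_def Pi_def)
      qed
      ultimately show "m \<in> form_exponents I n d"
        by (simp add: form_exponents_def)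
    qed
  qed
  have card_L: "card (?L i) = (n i + d i) choose (d i)" for i
    by (simp add: card_length_sum_list add.commute)
  \<comment> \<open>Infinite sets have cardinality 0, so a positive binomial coefficient already
    gives finiteness.\<close>
  then have "finite (?L i)" for i
    by (intro card_ge_0_finite) simp
  then show "finite (form_exponents I n d)"
    using bij_betw_finite[OF bij] assms by (simp add: finite_PiE)
  show "card (form_exponents I n d) = (\<Prod>i\<in>I. (n i + d i) choose (d i))"
    using bij_betw_same_card[OF bij] assms by (simp add: card_PiE card_L)
qed

lemma lookup_poly_scale: "Poly_Mapping.lookup (poly_scale c f) m = c * Poly_Mapping.lookup f m"
  by (simp add: poly_scale_def Poly_Mapping.map.rep_eq when_def)

lemma single_one_eq_iff:
  "Poly_Mapping.single m (1::complex) = Poly_Mapping.single m' 1 \<longleftrightarrow> m = m'"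
proof
  assume "Poly_Mapping.single m (1::complex) = Poly_Mapping.single m' 1"
  then have "Poly_Mapping.keys (Poly_Mapping.single m (1::complex)) = Poly_Mapping.keys (Poly_Mapping.single m' (1::complex))"
    by simp
  then show "m = m'"
    by simp
qed simp

lemma monomials_basis:
  fixes M :: "('v \<Rightarrow>\<^sub>0 nat) set"
  shows "cpoly.independent ((\<lambda>m. Poly_Mapping.single m 1) ` M)"
    and "Poly_Mapping.keys f \<subseteq> M \<Longrightarrow> f \<in> cpoly.span ((\<lambda>m. Poly_Mapping.single m 1) ` M)"
proof -
  show "cpoly.independent ((\<lambda>m. Poly_Mapping.single m 1) ` M)"
    unfolding cpoly.independent_explicit_finite_subsets
  proof (intro allI impI ballI)
    fix S u b
    assume S: "S \<subseteq> (\<lambda>m. Poly_Mapping.single m 1) ` M" "finite S"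
      and sum: "(\<Sum>b\<in>S. poly_scale (u b) b) = 0" and b: "b \<in> S"
    obtain m where m: "b = Poly_Mapping.single m 1"
      using S b by blast
    have "(\<Sum>c\<in>S. Poly_Mapping.lookup (poly_scale (u c) c) m) = (\<Sum>c\<in>S. if c = b then u b else 0)"
    proof (rule sum.cong)
      fix c assume "c \<in> S"
      then obtain m' where "c = Poly_Mapping.single m' 1"
        using S by blast
      then show "Poly_Mapping.lookup (poly_scale (u c) c) m = (if c = b then u b else 0)"
        by (auto simp: m lookup_poly_scale lookup_single when_def single_one_eq_iff)
    qed simp
    also have "\<dots> = u b"
      using S b by simp
    also have "(\<Sum>c\<in>S. Poly_Mapping.lookup (poly_scale (u c) c) m) = 0"
      by (simp add: lookup_sum[symmetric] sum)
    finally show "u b = 0"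
      by simp
  qed
  show "f \<in> cpoly.span ((\<lambda>m. Poly_Mapping.single m 1) ` M)" if "Poly_Mapping.keys f \<subseteq> M"
  proof -
    have "(\<Sum>m\<in>Poly_Mapping.keys f. poly_scale (Poly_Mapping.lookup f m) (Poly_Mapping.single m 1))
        \<in> cpoly.span ((\<lambda>m. Poly_Mapping.single m 1) ` M)"
      using that by (intro cpoly.span_sum cpoly.span_scale cpoly.span_base) auto
    also have "(\<Sum>m\<in>Poly_Mapping.keys f. poly_scale (Poly_Mapping.lookup f m) (Poly_Mapping.single m 1)) = f"
      by (subst (3) poly_mapping_sum_single) (simp add: poly_scale_eq cst_def mult_single)
    finally show ?thesis .
  qed
qed

lemma forms_finite_span:
  assumes "finite I"
  shows "\<exists>B. finite B \<and> forms I n d \<subseteq> cpoly.span B"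
  using card_form_exponents(1)[OF assms, of n d] monomials_basis(2)[where M = "form_exponents I n d"]
  by (intro exI[of _ "(\<lambda>m. Poly_Mapping.single m 1) ` form_exponents I n d"]) (auto simp: forms_iff)

lemma dim_forms:
  assumes "finite I"
  shows "cpoly.dim (forms I n d) = (\<Prod>i\<in>I. (n i + d i) choose (d i))"
proof -
  let ?b = "\<lambda>m. Poly_Mapping.single m (1::complex)"
  let ?M = "form_exponents I n d"
  have "inj ?b"
    by (simp add: inj_def single_one_eq_iff)
  then have "card (?b ` ?M) = card ?M"
    by (intro card_image) (blast intro: inj_on_subset)
  moreover have "cpoly.dim (forms I n d) = card (?b ` ?M)"
    using monomials_basis(1)[of ?M] monomials_basis(2)[of _ ?M]
    by (intro cpoly.dim_unique) (auto simp: forms_iff)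
  ultimately show ?thesis
    using card_form_exponents(2)[OF assms] by simp
qed

text \<open>Used in two ways: at a fibre double point it recovers the value from the derivatives
  (degree 1 in the first factor); at a double point it recovers one derivative per factor from the
  value and the others.\<close>

lemma euler_identity:
  assumes "f \<in> forms I n d" "i \<in> I"
  shows "(\<Sum>j\<le>n i. x (i, j) * dir_deriv x (unit_fun (i, j)) f) = of_nat (d i) * poly_eval x f"
  using assms(1)
proof (induction rule: forms_induct)
  case (mvar d f i' j')
  have "(\<Sum>j\<le>n i. x (i, j) * dir_deriv x (unit_fun (i, j)) (mvar (i', j') * f)) =
      x (i', j') * (\<Sum>j\<le>n i. x (i, j) * dir_deriv x (unit_fun (i, j)) f) +
      (\<Sum>j\<le>n i. if j = j' then (if i = i' then x (i', j') * poly_eval x f else 0) else 0)"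
    unfolding sum_distrib_left sum.distrib[symmetric]
    by (intro sum.cong) (auto simp: dir_deriv_mult unit_fun_def algebra_simps)
  also have "(\<Sum>j\<le>n i. if j = j' then (if i = i' then x (i', j') * poly_eval x f else 0) else 0) =
      (if i = i' then x (i', j') * poly_eval x f else 0)"
    using mvar by (subst sum.delta) auto
  finally show ?case
    using mvar by (auto simp: poly_eval_hom.hom_mult algebra_simps)
qed (simp_all add: dir_deriv_add poly_eval_hom.hom_add distrib_left sum.distrib assms(2))

lemma forms_scale_coords:
  assumes "f \<in> forms I n d" "finite I"
    and y: "\<And>i j. i \<in> I \<Longrightarrow> j \<le> n i \<Longrightarrow> y (i, j) = c i * x (i, j)"
  shows "poly_eval y f = (\<Prod>i\<in>I. c i ^ d i) * poly_eval x f"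
  using assms(1)
proof (induction rule: forms_induct)
  case (mvar d f i j)
  have "(\<Prod>i'\<in>I. c i' ^ (d(i := Suc (d i))) i') = c i * (\<Prod>i'\<in>I. c i' ^ d i')"
    using mvar assms(2) by (simp add: prod.remove[of I i])
  then show ?case
    using mvar y by (simp add: poly_eval_hom.hom_mult)
qed (simp_all add: poly_eval_hom.hom_add distrib_left)

lemma partial_deriv_forms:
  assumes "f \<in> forms I n d" "i \<in> I"
  shows "partial_deriv (i, j) f \<in> forms I n (d(i := d i - 1))"
    and "d i = 0 \<Longrightarrow> partial_deriv (i, j) f = 0"
proof -
  have "partial_deriv (i, j) f \<in> forms I n (d(i := d i - 1)) \<and> (d i = 0 \<longrightarrow> partial_deriv (i, j) f = 0)"
    using assms(1)
  proof (induction rule: forms_induct)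
    case (mvar d f i' j')
    have 1: "mvar (i', j') * partial_deriv (i, j) f \<in>
        forms I n ((d(i' := Suc (d i')))(i := (d(i' := Suc (d i'))) i - 1))"
    proof (cases "d i = 0")
      case True
      then show ?thesis
        using mvar by (simp add: forms_0)
    next
      case False
      have "mvar (i', j') * partial_deriv (i, j) f \<in>
          forms I n (\<lambda>i''. (if i'' = i' then 1 else 0) + (d(i := d i - 1)) i'')"
        using mvar by (intro forms_mult forms_mvar) (auto simp: coord_vars_iff)
      also have "\<dots> = forms I n ((d(i' := Suc (d i')))(i := (d(i' := Suc (d i'))) i - 1))"
        using False by (intro forms_cong) auto
      finally show ?thesis .
    qed
    have 2: "(if (i', j') = (i, j) then f else 0) \<in>
        forms I n ((d(i' := Suc (d i')))(i := (d(i' := Suc (d i'))) i - 1))"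
      using mvar by (cases "(i', j') = (i, j)") (simp_all add: forms_0)
    have eq: "partial_deriv (i, j) (mvar (i', j') * f) =
        mvar (i', j') * partial_deriv (i, j) f + (if (i', j') = (i, j) then f else 0)"
      by (simp add: partial_deriv_mult)
    have "partial_deriv (i, j) (mvar (i', j') * f) = 0" if "(d(i' := Suc (d i'))) i = 0"
      using that mvar by (auto simp: eq split: if_splits)
    then show ?case
      using forms_add[OF 1 2] unfolding eq by blast
  qed (use assms(2) in \<open>simp_all add: forms_0 partial_deriv_add forms_add\<close>)
  then show "partial_deriv (i, j) f \<in> forms I n (d(i := d i - 1))"
    and "d i = 0 \<Longrightarrow> partial_deriv (i, j) f = 0"
    by auto
qed

lemma dir_deriv_degree_0:
  assumes "f \<in> forms I n d" "i \<in> I" "d i = 0"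
  shows "dir_deriv x (unit_fun (i, j)) f = 0"
  using partial_deriv_forms(2)[OF assms, of j] poly_eval_partial_deriv[of x "(i, j)" f] by simp

lemma poly_eval_degree_0:
  assumes "f \<in> forms I n d" "d i = 0"
    and "\<And>i' j. i' \<in> I \<Longrightarrow> i' \<noteq> i \<Longrightarrow> j \<le> n i' \<Longrightarrow> x (i', j) = y (i', j)"
  shows "poly_eval x f = poly_eval y f"
  using assms(1,2)
proof (induction rule: forms_induct)
  case (mvar d f i' j')
  then show ?case
    using assms(3) by (cases "i' = i") (auto simp: poly_eval_hom.hom_mult)
qed (simp_all add: poly_eval_hom.hom_add)

text \<open>The partial derivative has degree 0 in factor \<open>i\<close>, so it ignores the
  coordinates there. This is what allows a fibre double point to be moved along its fibre and a
  double point to act on the other coordinate subspace.\<close>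

lemma dir_deriv_degree_1:
  assumes "f \<in> forms I n d" "i \<in> I" "d i = 1"
    and "\<And>i' j. i' \<in> I \<Longrightarrow> i' \<noteq> i \<Longrightarrow> j \<le> n i' \<Longrightarrow> x (i', j) = y (i', j)"
  shows "dir_deriv x (unit_fun (i, j)) f = dir_deriv y (unit_fun (i, j)) f"
proof -
  have "poly_eval x (partial_deriv (i, j) f) = poly_eval y (partial_deriv (i, j) f)"
    using poly_eval_degree_0[OF partial_deriv_forms(1)[OF assms(1,2)], of i x y] assms(3,4) by simp
  then show ?thesis
    by (simp add: poly_eval_partial_deriv)
qed

text \<open>\<open>\<phi>\<close> tells which factor the variables of a factor go to; injectivity
  keeps different degrees from adding up. It is \<open>Pair l\<close> when a form is placed at the
  \<open>l\<close>-th point of a tuple and \<open>id\<close> for the restriction to coordinate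
  subspaces, where some variables are sent to 0, a form of every degree.\<close>

lemma forms_subst:
  assumes "f \<in> forms I n d" "inj_on \<phi> I" "\<phi> ` I \<subseteq> I'"
    and s: "\<And>i j. i \<in> I \<Longrightarrow> j \<le> n i \<Longrightarrow> s (i, j) \<in> forms I' n' (\<lambda>i'. if i' = \<phi> i then 1 else 0)"
    and d': "\<And>i. i \<in> I \<Longrightarrow> d' (\<phi> i) = d i" "\<And>i'. i' \<in> I' \<Longrightarrow> i' \<notin> \<phi> ` I \<Longrightarrow> d' i' = 0"
  shows "poly_subst s f \<in> forms I' n' d'"
  using assms(1) d'
proof (induction arbitrary: d' rule: forms_induct)
  case (cst d c)
  have "d' i' = 0" if "i' \<in> I'" for i'
    using that cst by (cases "i' \<in> \<phi> ` I") auto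
  then show ?case
    unfolding poly_subst_cst by (rule forms_cst)
next
  case (mvar d f i j)
  let ?e = "d'(\<phi> i := d i)"
  have "\<phi> i' = \<phi> i \<longleftrightarrow> i' = i" if "i' \<in> I" for i'
    using that mvar assms(2) by (auto dest: inj_onD)
  then have "poly_subst s f \<in> forms I' n' ?e"
    using mvar.prems mvar.hyps by (intro mvar.IH) auto
  then have "s (i, j) * poly_subst s f \<in> forms I' n' (\<lambda>i'. (if i' = \<phi> i then 1 else 0) + ?e i')"
    by (rule forms_mult[OF s[OF mvar.hyps(2,3)]])
  also have "\<dots> = forms I' n' d'"
    using mvar.prems(1)[OF mvar.hyps(2)] by (intro forms_cong) auto
  finally show ?case
    by (simp add: poly_subst_hom.hom_mult)
next
  case (zero d)
  show ?case
    by (simp add: forms_0)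
next
  case (add d f g)
  show ?case
    unfolding poly_subst_hom.hom_add using add by (intro forms_add) auto
qed

section \<open>Ideals of points, double points and fibre double points\<close>

interpretation cst_hom: comm_ring_hom cst
  by (rule cst_hom)

lemma proj_space_nonzero:
  assumes "X \<in> proj_space n" "u \<in> X"
  shows "u \<in> nonzero_vectors n"
proof -
  obtain u0 where "u0 \<in> nonzero_vectors n" "X = scaling_rel `` {u0}"
    using assms(1) unfolding proj_space_def by (rule quotientE)
  then show ?thesis
    using assms(2) by (auto simp: scaling_rel_def nonzero_vectors_def)
qed

lemma proj_space_scale:
  assumes "X \<in> proj_space n" "u \<in> X" "w \<in> X"
  shows "\<exists>c. c \<noteq> 0 \<and> w = (\<lambda>j. c * u j)"
proof -
  obtain u0 where "X = scaling_rel `` {u0}"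
    using assms(1) unfolding proj_space_def by (rule quotientE)
  then obtain c d where "c \<noteq> 0" "u = (\<lambda>j. c * u0 j)" "w = (\<lambda>j. d * u0 j)" "d \<noteq> 0"
    using assms(2,3) by (auto simp: scaling_rel_def)
  then show ?thesis
    by (intro exI[of _ "d / c"]) auto
qed

lemma scaling_class_self: "u \<in> scaling_rel `` {u}"
  by (auto simp: scaling_rel_def intro: exI[of _ 1])

lemma scaling_class_proj_space: "u \<in> nonzero_vectors n \<Longrightarrow> scaling_rel `` {u} \<in> proj_space n"
  unfolding proj_space_def by (rule quotientI)

lemma homog_coords_nonempty:
  assumes "P \<in> mproj_space I n"
  shows "\<exists>x. x \<in> homog_coords I P"
proof -
  have "\<exists>u. u \<in> P i" if i: "i \<in> I" for i
  proof -
    have "P i \<in> proj_space (n i)"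
      using assms i by (auto simp: mproj_space_def)
    then obtain u0 where "P i = scaling_rel `` {u0}"
      unfolding proj_space_def by (rule quotientE)
    then show ?thesis
      using scaling_class_self by blast
  qed
  then obtain u where "\<And>i. i \<in> I \<Longrightarrow> u i \<in> P i"
    by metis
  then show ?thesis
    by (intro exI[of _ "\<lambda>(i, j). u i j"]) (simp add: homog_coords_def)
qed

lemma homog_coords_scale:
  assumes "P \<in> mproj_space I n" "x \<in> homog_coords I P" "y \<in> homog_coords I P"
  shows "\<exists>c. \<forall>i\<in>I. c i \<noteq> 0 \<and> (\<forall>j. y (i, j) = c i * x (i, j))"
proof -
  have "\<exists>c. c \<noteq> 0 \<and> (\<forall>j. y (i, j) = c * x (i, j))" if "i \<in> I" for i
  proof -
    have "P i \<in> proj_space (n i)" "(\<lambda>j. x (i, j)) \<in> P i" "(\<lambda>j. y (i, j)) \<in> P i"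
      using assms that by (auto simp: mproj_space_def homog_coords_def)
    then obtain c where "c \<noteq> 0" "(\<lambda>j. y (i, j)) = (\<lambda>j. c * x (i, j))"
      using proj_space_scale by blast
    then show ?thesis
      by (metis (full_types))
  qed
  then show ?thesis
    by metis
qed

lemma homog_coords_nonzero:
  assumes "P \<in> mproj_space I n" "x \<in> homog_coords I P" "i \<in> I"
  shows "(\<lambda>j. x (i, j)) \<in> nonzero_vectors (n i)"
  using proj_space_nonzero[of "P i" "n i"] assms by (auto simp: mproj_space_def homog_coords_def)

lemma vanishes_at_iff:
  assumes "f \<in> forms I n d" "finite I" "P \<in> mproj_space I n" "x \<in> homog_coords I P"
  shows "vanishes_at I f P \<longleftrightarrow> poly_eval x f = 0"
proof
  assume x: "poly_eval x f = 0"
  show "vanishes_at I f P"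
    unfolding vanishes_at_def
  proof
    fix y assume "y \<in> homog_coords I P"
    then obtain c where "\<forall>i\<in>I. c i \<noteq> 0 \<and> (\<forall>j. y (i, j) = c i * x (i, j))"
      using homog_coords_scale assms by blast
    then show "poly_eval y f = 0"
      using forms_scale_coords[OF assms(1,2), of y c x] x by simp
  qed
qed (use assms(4) in \<open>simp add: vanishes_at_def\<close>)

section \<open>Ideals of the coordinate ring\<close>

lemma coord_ring_idealI:
  assumes "J \<subseteq> carrier (coord_ring I n)" "0 \<in> J" "\<And>f g. f \<in> J \<Longrightarrow> g \<in> J \<Longrightarrow> f + g \<in> J"
    and mult: "\<And>f g. f \<in> carrier (coord_ring I n) \<Longrightarrow> g \<in> J \<Longrightarrow> f * g \<in> J"
  shows "ideal J (coord_ring I n)"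
proof -
  interpret cring "coord_ring I n" by (rule cring_coord_ring)
  show ?thesis
  proof (rule idealI[OF ring_axioms])
    show "subgroup J (add_monoid (coord_ring I n))"
    proof (rule add.subgroupI)
      fix f assume f: "f \<in> J"
      then have "f \<in> carrier (coord_ring I n)"
        using assms(1) by blast
      moreover have "cst (- 1) * f \<in> J"
        using f by (intro mult carrier_cst)
      moreover have eq: "cst (- 1) * f = - f"
        by (simp add: cst_hom.hom_uminus)
      ultimately have "\<ominus>\<^bsub>coord_ring I n\<^esub> f = - f"
        using assms(1) by (intro minus_equality) auto
      then show "\<ominus>\<^bsub>coord_ring I n\<^esub> f \<in> J"
        using \<open>cst (- 1) * f \<in> J\<close> eq by simp
    qed (use assms in auto)
    show "h \<otimes>\<^bsub>coord_ring I n\<^esub> f \<in> J" if "f \<in> J" "h \<in> carrier (coord_ring I n)" for f h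
      using that by (simp add: mult)
    show "f \<otimes>\<^bsub>coord_ring I n\<^esub> h \<in> J" if "f \<in> J" "h \<in> carrier (coord_ring I n)" for f h
      using mult[OF that(2,1)] by (simp add: mult.commute)
  qed
qed

lemma
  assumes "ideal J (coord_ring I n)"
  shows coord_ring_ideal_0: "0 \<in> J"
    and coord_ring_ideal_add: "f \<in> J \<Longrightarrow> g \<in> J \<Longrightarrow> f + g \<in> J"
    and coord_ring_ideal_mult: "h \<in> carrier (coord_ring I n) \<Longrightarrow> f \<in> J \<Longrightarrow> h * f \<in> J"
proof -
  interpret ideal J "coord_ring I n" by fact
  show "0 \<in> J"
    using additive_subgroup.zero_closed[OF additive_subgroup_axioms] by simp
  show "f \<in> J \<Longrightarrow> g \<in> J \<Longrightarrow> f + g \<in> J"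
    using additive_subgroup.a_closed[OF additive_subgroup_axioms, of f g] by simp
  show "h \<in> carrier (coord_ring I n) \<Longrightarrow> f \<in> J \<Longrightarrow> h * f \<in> J"
    using I_l_closed[of f h] by simp
qed

lemma coord_ring_ideal_sum:
  assumes "ideal J (coord_ring I n)" "\<And>x. x \<in> A \<Longrightarrow> f x \<in> J"
  shows "sum f A \<in> J"
  using assms(2) by (induction A rule: infinite_finite_induct)
    (simp_all add: coord_ring_ideal_0[OF assms(1)] coord_ring_ideal_add[OF assms(1)])

lemma vanishing_ideal_ideal: "ideal (vanishing_ideal I n X) (coord_ring I n)"
proof -
  interpret cring "coord_ring I n" by (rule cring_coord_ring)
  show ?thesis
    unfolding vanishing_ideal_def by (rule genideal_ideal) (auto dest: forms_carrier)
qed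

lemma vanishing_idealI:
  assumes "f \<in> forms I n d" "\<And>P. P \<in> X \<Longrightarrow> vanishes_at I f P"
  shows "f \<in> vanishing_ideal I n X"
proof -
  interpret cring "coord_ring I n" by (rule cring_coord_ring)
  have "{f \<in> (\<Union>d. forms I n d). \<forall>P\<in>X. vanishes_at I f P} \<subseteq> carrier (coord_ring I n)"
    by (auto dest: forms_carrier)
  then show ?thesis
    unfolding vanishing_ideal_def using assms by (intro subsetD[OF genideal_self]) auto
qed

text \<open>Elements of the ideal need not be homogeneous, but the polynomials vanishing at the
  fixed vector \<open>x\<close> form an ideal that contains all generators.\<close>

lemma vanishing_idealD:
  assumes "f \<in> vanishing_ideal I n X" "P \<in> X" "x \<in> homog_coords I P"
  shows "poly_eval x f = 0"
proof -
  interpret cring "coord_ring I n" by (rule cring_coord_ring)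
  let ?J = "{f \<in> carrier (coord_ring I n). poly_eval x f = 0}"
  have "ideal ?J (coord_ring I n)"
    by (rule coord_ring_idealI)
      (auto simp: carrier_0 carrier_add carrier_mult poly_eval_hom.hom_add poly_eval_hom.hom_mult)
  then have "vanishing_ideal I n X \<subseteq> ?J"
    unfolding vanishing_ideal_def using assms(2,3)
    by (intro genideal_minimal) (auto dest: forms_carrier simp: vanishes_at_def)
  then show ?thesis
    using assms(1) by blast
qed

lemma double_point_ideal_ideal: "ideal (double_point_ideal k n P) (coord_ring {1..k} n)"
proof -
  interpret cring "coord_ring {1..k} n" by (rule cring_coord_ring)
  show ?thesis
    unfolding double_point_ideal_def point_ideal_def
    by (intro ideal_prod_is_ideal vanishing_ideal_ideal)
qed

text \<open>For a product of two polynomials vanishing at \<open>x\<close>, both terms of the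
  Leibniz rule vanish.\<close>

lemma double_point_idealD:
  assumes "f \<in> double_point_ideal k n P" "x \<in> homog_coords {1..k} P"
  shows "poly_eval x f = 0 \<and> dir_deriv x v f = 0"
  using assms(1) unfolding double_point_ideal_def
proof (induction rule: ideal_prod.induct)
  case (prod f g)
  then have "poly_eval x f = 0" "poly_eval x g = 0"
    using assms(2) vanishing_idealD unfolding point_ideal_def by blast+
  then show ?case
    by (simp add: dir_deriv_mult poly_eval_hom.hom_mult)
qed (simp add: dir_deriv_add poly_eval_hom.hom_add)

text \<open>A polynomial vanishing on the fibre vanishes on the lines through \<open>x\<close> in the directions of
  the first factor, except possibly at the one point where the head of the coordinate vector is zero.\<close>

lemma fibre_ideal_deriv:
  assumes "f \<in> vanishing_ideal {1..k} n (fibre k n P)" "1 \<le> k"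
    and P: "P \<in> mproj_space {1..k} n" and x: "x \<in> homog_coords {1..k} P" and j: "j \<le> n 1"
  shows "poly_eval x f = 0" "dir_deriv x (unit_fun (1, j)) f = 0"
proof -
  let ?x = "\<lambda>t w. x w + t * unit_fun (1, j) w"
  have zero: "poly (on_line x (unit_fun (1, j)) f) t = 0" if t: "t \<noteq> - x (1, j)" for t
  proof -
    let ?u = "\<lambda>j'. ?x t (1, j')"
    define Q where "Q = P(1 := scaling_rel `` {?u})"
    have "?u j \<noteq> 0"
      using t by (simp add: unit_fun_def add_eq_0_iff)
    moreover have "?u j' = 0" if "j' > n 1" for j'
      using that j homog_coords_nonzero[OF P x, of 1] \<open>1 \<le> k\<close>
      by (simp add: unit_fun_def nonzero_vectors_def)
    ultimately have "?u \<in> nonzero_vectors (n 1)"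
      by (auto simp: nonzero_vectors_def)
    then have "Q \<in> mproj_space {1..k} n"
      using P \<open>1 \<le> k\<close> by (auto simp: Q_def mproj_space_def PiE_def Pi_def extensional_def scaling_class_proj_space)
    then have "Q \<in> fibre k n P"
      by (auto simp: fibre_def proj_tail_def Q_def)
    moreover have "?x t \<in> homog_coords {1..k} Q"
    proof -
      have "(\<lambda>j'. ?x t (i, j')) = (\<lambda>j'. x (i, j'))" if "i \<noteq> 1" for i
        using that by (simp add: unit_fun_def)
      then show ?thesis
        using x scaling_class_self[of ?u] by (auto simp: homog_coords_def Q_def)
    qed
    ultimately show ?thesis
      using vanishing_idealD[OF assms(1)] by (simp add: poly_on_line)
  qed
  have "on_line x (unit_fun (1, j)) f = 0"
  proof (rule ccontr)
    assume "on_line x (unit_fun (1, j)) f \<noteq> 0"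
    then have "finite {t. poly (on_line x (unit_fun (1, j)) f) t = 0}"
      by (rule poly_roots_finite)
    moreover have "UNIV - {- x (1, j)} \<subseteq> {t. poly (on_line x (unit_fun (1, j)) f) t = 0}"
      using zero by auto
    ultimately have "finite (UNIV - {- x (1, j)})"
      by (rule finite_subset[rotated])
    then show False
      using infinite_UNIV_char_0[where 'a = complex] by simp
  qed
  then show "poly_eval x f = 0" "dir_deriv x (unit_fun (1, j)) f = 0"
    using coeff_0_on_line[of x "unit_fun (1, j)" f] by (simp_all add: dir_deriv_def)
qed

lemma fibre_double_point_idealD:
  assumes "f \<in> fibre_double_point_ideal k n P" "1 \<le> k"
    and "P \<in> mproj_space {1..k} n" "x \<in> homog_coords {1..k} P" "j \<le> n 1"
  shows "poly_eval x f = 0 \<and> dir_deriv x (unit_fun (1, j)) f = 0"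
proof -
  obtain g h where "f = g + h" "g \<in> double_point_ideal k n P"
      "h \<in> vanishing_ideal {1..k} n (fibre k n P)"
    using assms(1) unfolding fibre_double_point_ideal_def set_add_def' by auto
  then show ?thesis
    using double_point_idealD[of g k n P x] fibre_ideal_deriv[of h k n P x j] assms(2-)
    by (simp add: poly_eval_hom.hom_add dir_deriv_add)
qed

lemma monomial_carrier:
  assumes "\<And>i. i \<in> I \<Longrightarrow> Y i \<in> carrier (coord_ring I n)"
  shows "(\<Prod>i\<in>I. Y i ^ d i) \<in> carrier (coord_ring I n)"
proof -
  have pow: "Y i ^ e \<in> carrier (coord_ring I n)" if "i \<in> I" for i e
    using assms[OF that] by (induction e) (simp_all add: carrier_1 carrier_mult)
  have "(\<Prod>i\<in>A. Y i ^ d i) \<in> carrier (coord_ring I n)" if "A \<subseteq> I" for A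
    using that by (induction A rule: infinite_finite_induct) (simp_all add: carrier_1 carrier_mult pow)
  then show ?thesis
    by blast
qed

text \<open>Modulo the square of the ideal of a point \<open>x\<close>, a form equals the homogenization of its first
  order Taylor polynomial at \<open>x\<close>. The chart is given by nonvanishing coordinates \<open>x (i, c i)\<close>;
  \<open>Y i\<close> is the \<open>i\<close>-th homogenizing variable, normalized to take the value 1 at \<open>x\<close>.\<close>

lemma taylor_mod_square:
  fixes c :: "'i \<Rightarrow> nat" and n :: "'i \<Rightarrow> nat" and x :: "'i \<times> nat \<Rightarrow> complex"
  defines "Y \<equiv> \<lambda>i. cst (1 / x (i, c i)) * mvar (i, c i)"
    and "L \<equiv> \<lambda>w. mvar w - cst (x w) * (cst (1 / x (fst w, c (fst w))) * mvar (fst w, c (fst w)))"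
  assumes "finite I" and c: "\<And>i. i \<in> I \<Longrightarrow> c i \<le> n i"
    and J: "ideal J (coord_ring I n)"
    and LL: "\<And>w w'. w \<in> coord_vars I n \<Longrightarrow> w' \<in> coord_vars I n \<Longrightarrow> L w * L w' \<in> J"
    and f: "f \<in> forms I n d"
  shows "f - (cst (poly_eval x f) * (\<Prod>i\<in>I. Y i ^ d i) +
           (\<Sum>w\<in>coord_vars I n. cst (dir_deriv x (unit_fun w) f) *
              ((\<Prod>i\<in>I. Y i ^ (d(fst w := d (fst w) - 1)) i) * L w))) \<in> J"
  using f
proof (induction rule: forms_induct)
  case (zero d)
  then show ?case
    by (simp add: coord_ring_ideal_0[OF J])
next
  case (add d f g)
  show ?case
    using coord_ring_ideal_add[OF J add.IH]
    by (simp add: poly_eval_hom.hom_add dir_deriv_add cst_hom.hom_add distrib_right sum.distrib algebra_simps)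
next
  case (cst d c)
  then show ?case
    by (simp add: coord_ring_ideal_0[OF J])
next
  case (mvar d f i0 j0)
  let ?V = "coord_vars I n" and ?w0 = "(i0, j0)"
  let ?M = "\<lambda>d. \<Prod>i\<in>I. Y i ^ d i" and ?D = "\<lambda>w. dir_deriv x (unit_fun w) f"
  let ?e = "\<lambda>w. d(fst w := d (fst w) - 1)" and ?d' = "d(i0 := Suc (d i0))"
  have V: "finite ?V"
    using \<open>finite I\<close> by (simp add: coord_vars_def)
  have w0: "?w0 \<in> ?V"
    using mvar by (simp add: coord_vars_iff)
  have Y: "Y i \<in> carrier (coord_ring I n)" if "i \<in> I" for i
    using that c by (simp add: Y_def carrier_mult carrier_cst carrier_mvar coord_vars_iff)
  have Suc: "?M (e(i0 := Suc (e i0))) = Y i0 * ?M e" for e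
    using mvar.hyps \<open>finite I\<close> by (simp add: prod.remove[of I i0] mult.assoc)
  have split: "mvar ?w0 = cst (x ?w0) * Y i0 + L ?w0"
    by (simp add: L_def Y_def)
  \<comment> \<open>The exponents agree unless \<open>d (fst w) = 0\<close>, where the subtraction
    truncates; in that case the derivative is zero.\<close>
  have shift: "cst (?D w) * ?M (?d'(fst w := ?d' (fst w) - 1)) = cst (?D w) * (Y i0 * ?M (?e w))"
    if "w \<in> ?V" for w
  proof (cases "d (fst w) = 0")
    case True
    then have "?D w = 0"
      using dir_deriv_degree_0[OF mvar.hyps(1), of "fst w" x "snd w"] that by (auto simp: coord_vars_def)
    then show ?thesis
      by simp
  next
    case False
    then have "?d'(fst w := ?d' (fst w) - 1) = (?e w)(i0 := Suc (?e w i0))"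
      by (auto simp: fun_eq_iff)
    then show ?thesis
      by (simp only: Suc)
  qed
  have upd: "?d'(i0 := ?d' i0 - 1) = d"
    by auto
  have new: "(\<Sum>w\<in>?V. cst (dir_deriv x (unit_fun w) (mvar ?w0 * f)) *
        (?M (?d'(fst w := ?d' (fst w) - 1)) * L w)) =
      cst (poly_eval x f) * (?M d * L ?w0) +
      cst (x ?w0) * Y i0 * (\<Sum>w\<in>?V. cst (?D w) * (?M (?e w) * L w))"
  proof -
    have "(\<Sum>w\<in>?V. cst (dir_deriv x (unit_fun w) (mvar ?w0 * f)) *
          (?M (?d'(fst w := ?d' (fst w) - 1)) * L w)) =
        (\<Sum>w\<in>?V. (if w = ?w0 then cst (poly_eval x f) * (?M d * L ?w0) else 0) +
          cst (x ?w0) * Y i0 * (cst (?D w) * (?M (?e w) * L w)))"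
    proof (rule sum.cong[OF refl])
      fix w assume w: "w \<in> ?V"
      let ?X = "?M (?d'(fst w := ?d' (fst w) - 1)) * L w"
      have "cst (dir_deriv x (unit_fun w) (mvar ?w0 * f)) * ?X =
          (if w = ?w0 then cst (poly_eval x f) else 0) * ?X + cst (x ?w0) * cst (?D w) * ?X"
        by (simp add: dir_deriv_mult unit_fun_def cst_hom.hom_add cst_hom.hom_mult distrib_right)
      also have "(if w = ?w0 then cst (poly_eval x f) else 0) * ?X =
          (if w = ?w0 then cst (poly_eval x f) * (?M d * L ?w0) else 0)"
        using upd by (cases "w = ?w0") (simp_all del: fun_upd_apply)
      also have "cst (x ?w0) * cst (?D w) * ?X =
          cst (x ?w0) * (cst (?D w) * ?M (?d'(fst w := ?d' (fst w) - 1))) * L w"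
        by (simp only: mult.assoc)
      also have "\<dots> = cst (x ?w0) * Y i0 * (cst (?D w) * (?M (?e w) * L w))"
        unfolding shift[OF w] by (simp only: ac_simps)
      finally show "cst (dir_deriv x (unit_fun w) (mvar ?w0 * f)) * ?X =
          (if w = ?w0 then cst (poly_eval x f) * (?M d * L ?w0) else 0) +
          cst (x ?w0) * Y i0 * (cst (?D w) * (?M (?e w) * L w))" .
    qed
    also have "\<dots> = cst (poly_eval x f) * (?M d * L ?w0) +
        cst (x ?w0) * Y i0 * (\<Sum>w\<in>?V. cst (?D w) * (?M (?e w) * L w))"
      using V w0 by (simp add: sum.distrib sum_distrib_left)
    finally show ?thesis .
  qed
  let ?S = "\<Sum>w\<in>?V. cst (?D w) * (?M (?e w) * L w)"
  \<comment> \<open>Multiplying the expansion of \<open>f\<close> by \<open>mvar ?w0\<close> and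
    splitting this variable as a multiple of \<open>Y i0\<close> plus \<open>L ?w0\<close> leaves
    one second order term, \<open>L ?w0 * ?S\<close>, a combination of products of two
    \<open>L\<close>'s.\<close>
  have "mvar ?w0 * (f - (cst (poly_eval x f) * ?M d + ?S)) + L ?w0 * ?S \<in> J"
  proof (rule coord_ring_ideal_add[OF J])
    show "mvar ?w0 * (f - (cst (poly_eval x f) * ?M d + ?S)) \<in> J"
      using mvar.IH w0 by (intro coord_ring_ideal_mult[OF J]) (simp_all add: carrier_mvar)
    have "L ?w0 * ?S = (\<Sum>w\<in>?V. (cst (?D w) * ?M (?e w)) * (L ?w0 * L w))"
      by (simp add: sum_distrib_left ac_simps)
    also have "\<dots> \<in> J"
      by (intro coord_ring_ideal_sum[OF J] coord_ring_ideal_mult[OF J] LL w0 carrier_mult carrier_cst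
          monomial_carrier Y)
    finally show "L ?w0 * ?S \<in> J" .
  qed
  also have "mvar ?w0 * (f - (cst (poly_eval x f) * ?M d + ?S)) + L ?w0 * ?S =
      mvar ?w0 * f - (cst (poly_eval x (mvar ?w0 * f)) * ?M ?d' +
        (cst (poly_eval x f) * (?M d * L ?w0) + cst (x ?w0) * Y i0 * ?S))"
    unfolding Suc poly_eval_hom.hom_mult cst_hom.hom_mult poly_eval_mvar
    by (subst (2) split) (simp add: split algebra_simps)
  finally show ?case
    unfolding new .
qed

section \<open>Configurations and their conditions\<close>

lemma nonzero_coord_choice:
  assumes "\<And>i. i \<in> I \<Longrightarrow> (\<lambda>j. x (i, j)) \<in> nonzero_vectors (n i)"
  shows "\<exists>c. \<forall>i\<in>I. c i \<le> n i \<and> x (i, c i) \<noteq> 0"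
proof -
  have "\<exists>j. j \<le> n i \<and> x (i, j) \<noteq> 0" if "i \<in> I" for i
    using assms[OF that] unfolding nonzero_vectors_def by (auto simp: not_le[symmetric])
  then show ?thesis
    by (intro bchoice) blast
qed

text \<open>When the value and all first derivatives vanish, the Taylor remainder is the form
  itself. The \<open>L w\<close> are linear forms through the point, so their products lie in the
  square of its ideal.\<close>

lemma double_point_idealI:
  assumes f: "f \<in> forms {1..k} n a"
    and P: "P \<in> mproj_space {1..k} n" and x: "x \<in> homog_coords {1..k} P"
    and zero: "poly_eval x f = 0" "\<And>w. w \<in> coord_vars {1..k} n \<Longrightarrow> dir_deriv x (unit_fun w) f = 0"
  shows "f \<in> double_point_ideal k n P"
proof -
  obtain c where c: "\<And>i. i \<in> {1..k} \<Longrightarrow> c i \<le> n i \<and> x (i, c i) \<noteq> 0"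
    using nonzero_coord_choice[of "{1..k}" x n, OF homog_coords_nonzero[OF P x]] by blast
  let ?L = "\<lambda>w. mvar w - cst (x w) * (cst (1 / x (fst w, c (fst w))) * mvar (fst w, c (fst w)))"
  have L: "?L w \<in> point_ideal k n P" if w: "w \<in> coord_vars {1..k} n" for w
  proof -
    obtain i j where ij: "w = (i, j)" "i \<in> {1..k}" "j \<le> n i"
      using w by (auto simp: coord_vars_def)
    let ?e = "\<lambda>i'. if i' = i then 1 else 0"
    have "?L w = mvar (i, j) + cst (- x w / x (i, c i)) * mvar (i, c i)"
      by (simp add: ij(1) mult.assoc[symmetric] cst_hom.hom_mult[symmetric] cst_hom.hom_uminus)
    moreover have "mvar (i, j) + cst (- x w / x (i, c i)) * mvar (i, c i) \<in> forms {1..k} n ?e"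
      using ij c by (intro forms_add forms_scale forms_mvar) (auto simp: coord_vars_iff)
    ultimately have L: "?L w \<in> forms {1..k} n ?e"
      by simp
    have "poly_eval x (?L w) = 0"
      using ij c by (simp add: poly_eval_hom.hom_minus poly_eval_hom.hom_mult)
    then have "vanishes_at {1..k} (?L w) Q" if "Q \<in> {P}" for Q
      using vanishes_at_iff[OF L _ P x] that by simp
    then show ?thesis
      unfolding point_ideal_def by (rule vanishing_idealI[OF L])
  qed
  have "f - (cst (poly_eval x f) * (\<Prod>i\<in>{1..k}. (cst (1 / x (i, c i)) * mvar (i, c i)) ^ a i) +
      (\<Sum>w\<in>coord_vars {1..k} n. cst (dir_deriv x (unit_fun w) f) *
        ((\<Prod>i\<in>{1..k}. (cst (1 / x (i, c i)) * mvar (i, c i)) ^ (a(fst w := a (fst w) - 1)) i) * ?L w)))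
      \<in> double_point_ideal k n P"
  proof (rule taylor_mod_square[OF _ _ double_point_ideal_ideal _ f])
    show "?L w * ?L w' \<in> double_point_ideal k n P"
      if "w \<in> coord_vars {1..k} n" "w' \<in> coord_vars {1..k} n" for w w'
      using ideal_prod.prod[OF L[OF that(1)] L[OF that(2)], of "coord_ring {1..k} n"]
      by (simp add: double_point_ideal_def)
  qed (use c in auto)
  then show ?thesis
    by (simp add: zero)
qed

text \<open>On a fibre the form is linear, and its coefficients are the derivatives along the first
  factor. If these vanish at \<open>x\<close>, the form vanishes on the whole fibre, so it already
  lies in the second summand of the ideal.\<close>

lemma fibre_double_point_idealI:
  assumes f: "f \<in> forms {1..k} n a" and "1 \<le> k" "a 1 = 1"
    and P: "P \<in> mproj_space {1..k} n" and x: "x \<in> homog_coords {1..k} P"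
    and zero: "\<And>j. j \<le> n 1 \<Longrightarrow> dir_deriv x (unit_fun (1, j)) f = 0"
  shows "f \<in> fibre_double_point_ideal k n P"
proof -
  have 1: "1 \<in> {1..k}"
    using \<open>1 \<le> k\<close> by simp
  have "poly_eval y f = 0" if Q: "Q \<in> fibre k n P" and y: "y \<in> homog_coords {1..k} Q" for Q y
  proof -
    \<comment> \<open>\<open>?y\<close> joins the first block of \<open>x\<close> to the tail of
      \<open>y\<close>. It represents \<open>P\<close>, hence is \<open>x\<close> up to a scalar in
      each factor, while derivatives along the first factor do not distinguish it from
      \<open>y\<close>.\<close>
    let ?Q = "Q(1 := P 1)" and ?y = "\<lambda>w. if fst w = 1 then x w else y w"
    have "?y \<in> homog_coords {1..k} P"
      unfolding homog_coords_def
    proof (intro CollectI ballI)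
      fix i assume i: "i \<in> {1..k}"
      show "(\<lambda>j. ?y (i, j)) \<in> P i"
      proof (cases "i = 1")
        case True
        then show ?thesis
          using x i by (simp add: homog_coords_def)
      next
        case False
        then have "Q i = P i"
          using Q i by (auto simp: fibre_def proj_tail_def restrict_def fun_eq_iff dest: spec[of _ i] split: if_splits)
        then show ?thesis
          using y i False by (auto simp: homog_coords_def)
      qed
    qed
    then obtain c where "\<forall>i\<in>{1..k}. c i \<noteq> 0 \<and> (\<forall>j. ?y (i, j) = c i * x (i, j))"
      using homog_coords_scale[OF P x] by blast
    then have c: "\<And>i j. i \<in> {1..k} \<Longrightarrow> ?y (i, j) = c i * x (i, j)"
      by blast
    have "dir_deriv y (unit_fun (1, j)) f = 0" if j: "j \<le> n 1" for j
    proof -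
      let ?p = "partial_deriv (1, j) f"
      note p = partial_deriv_forms(1)[OF f 1, of j]
      have "dir_deriv y (unit_fun (1, j)) f = poly_eval y ?p"
        by (simp add: poly_eval_partial_deriv)
      also have "\<dots> = poly_eval ?y ?p"
        using \<open>a 1 = 1\<close> by (intro poly_eval_degree_0[OF p, of 1]) auto
      also have "\<dots> = (\<Prod>i\<in>{1..k}. c i ^ (a(1 := a 1 - 1)) i) * poly_eval x ?p"
        by (rule forms_scale_coords[OF p]) (use c in auto)
      also have "poly_eval x ?p = 0"
        using zero[OF j] by (simp add: poly_eval_partial_deriv)
      finally show ?thesis
        by simp
    qed
    then show ?thesis
      using euler_identity[OF f 1, of y] \<open>a 1 = 1\<close> by simp
  qed
  then have "f \<in> vanishing_ideal {1..k} n (fibre k n P)"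
    using f by (intro vanishing_idealI[of f]) (auto simp: vanishes_at_def)
  then have "0 + f \<in> fibre_double_point_ideal k n P"
    unfolding fibre_double_point_ideal_def set_add_def'
    using coord_ring_ideal_0[OF double_point_ideal_ideal, of k n P] by (intro UN_I) auto
  then show ?thesis
    by simp
qed

text \<open>\<open>(l, None)\<close> stands for the value and
  \<open>(l, Some w)\<close> for the derivative in direction \<open>w\<close> at the \<open>l\<close>-th point.\<close>

fun point_cond :: "(nat \<Rightarrow> nat \<times> nat \<Rightarrow> complex) \<Rightarrow> nat \<times> (nat \<times> nat) option \<Rightarrow>
    (nat \<times> nat) cpoly \<Rightarrow> complex" where
  "point_cond x (l, None) f = poly_eval (x l) f"
| "point_cond x (l, Some w) f = dir_deriv (x l) (unit_fun w) f"

text \<open>A fibre double point contributes no value condition, since Euler's relation with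
  \<open>a 1 = 1\<close> yields it. At a double point all partial derivatives are listed, so there
  are more conditions than its degree.\<close>

definition config_conds :: "nat \<Rightarrow> (nat \<Rightarrow> nat) \<Rightarrow> nat \<Rightarrow> nat \<Rightarrow> nat \<Rightarrow> (nat \<times> (nat \<times> nat) option) set" where
  "config_conds k n s t v = {..<s + t} \<times> {None} \<union> {..<s} \<times> Some ` coord_vars {1..k} n \<union>
     {s + t..<s + t + v} \<times> Some ` ({1} \<times> {..n 1})"

definition config_sections :: "nat \<Rightarrow> (nat \<Rightarrow> nat) \<Rightarrow> (nat \<Rightarrow> nat) \<Rightarrow> nat \<Rightarrow> nat \<Rightarrow> nat \<Rightarrow>
    (nat \<Rightarrow> nat \<times> nat \<Rightarrow> complex) \<Rightarrow> (nat \<times> nat) cpoly set" where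
  "config_sections k n a s t v x =
     {f \<in> forms {1..k} n a. \<forall>c\<in>config_conds k n s t v. point_cond x c f = 0}"

lemma config_sections_iff:
  "f \<in> config_sections k n a s t v x \<longleftrightarrow> f \<in> forms {1..k} n a \<and>
     (\<forall>l<s. poly_eval (x l) f = 0 \<and> (\<forall>w\<in>coord_vars {1..k} n. dir_deriv (x l) (unit_fun w) f = 0)) \<and>
     (\<forall>l<t. poly_eval (x (s + l)) f = 0) \<and>
     (\<forall>l<v. \<forall>j\<le>n 1. dir_deriv (x (s + t + l)) (unit_fun (1, j)) f = 0)"
  (is "?l \<longleftrightarrow> ?r")
proof
  assume ?l
  then have f: "f \<in> forms {1..k} n a" and c: "\<And>c. c \<in> config_conds k n s t v \<Longrightarrow> point_cond x c f = 0"
    by (auto simp: config_sections_def)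
  have "poly_eval (x l) f = 0" if "l < s + t" for l
    using c[of "(l, None)"] that by (simp add: config_conds_def)
  moreover have "dir_deriv (x l) (unit_fun w) f = 0" if "l < s" "w \<in> coord_vars {1..k} n" for l w
    using c[of "(l, Some w)"] that by (simp add: config_conds_def)
  moreover have "dir_deriv (x (s + t + l)) (unit_fun (1, j)) f = 0" if "l < v" "j \<le> n 1" for l j
    using c[of "(s + t + l, Some (1, j))"] that by (simp add: config_conds_def)
  ultimately show ?r
    using f by simp
next
  assume r: ?r
  have "poly_eval (x l) f = 0" if "l < s + t" for l
  proof (cases "l < s")
    case False
    then have "l - s < t"
      using that by simp
    then have "poly_eval (x (s + (l - s))) f = 0"
      using r by blast
    then show ?thesis
      using False by simp
  qed (use r in simp)
  moreover have "dir_deriv (x l) (unit_fun (1, j)) f = 0" if "s + t \<le> l" "l < s + t + v" "j \<le> n 1" for l j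
  proof -
    have "l - (s + t) < v"
      using that by simp
    then have "dir_deriv (x (s + t + (l - (s + t)))) (unit_fun (1, j)) f = 0"
      using r that(3) by blast
    then show ?thesis
      using that(1) by simp
  qed
  ultimately show ?l
    using r by (auto simp: config_sections_def config_conds_def)
qed

text \<open>If \<open>g\<close> does not vanish at the point and \<open>g * f\<close> satisfies the
  conditions there, the Leibniz rule passes them on to \<open>f\<close>. Conversely the conditions
  put \<open>f\<close> itself into the ideal, so the denominator 1 serves at every point.\<close>

lemma ideal_sections_config:
  assumes "1 \<le> k" "a 1 = 1"
    and P: "\<And>l. l < s + t + v \<Longrightarrow> P l \<in> mproj_space {1..k} n"
    and x: "\<And>l. l < s + t + v \<Longrightarrow> x l \<in> homog_coords {1..k} (P l)"
  shows "ideal_sections {1..k} n (config_ideal k n s t v P (\<lambda>l. P (s + l)) (\<lambda>l. P (s + t + l))) a =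
    config_sections k n a s t v x"
proof (intro equalityI subsetI)
  fix f assume f: "f \<in> ideal_sections {1..k} n
    (config_ideal k n s t v P (\<lambda>l. P (s + l)) (\<lambda>l. P (s + t + l))) a"
  have g: "\<exists>g. poly_eval (x l) g \<noteq> 0 \<and> g * f \<in> config_ideal k n s t v P (\<lambda>l. P (s + l)) (\<lambda>l. P (s + t + l))"
    if l: "l < s + t + v" for l
  proof -
    obtain g d where "g \<in> forms {1..k} n d" "\<not> vanishes_at {1..k} g (P l)"
        "g * f \<in> config_ideal k n s t v P (\<lambda>l. P (s + l)) (\<lambda>l. P (s + t + l))"
      using f P[OF l] unfolding ideal_sections_def by blast
    then show ?thesis
      using vanishes_at_iff[of g "{1..k}" n d "P l" "x l"] P[OF l] x[OF l] by auto
  qed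
  have "poly_eval (x l) f = 0 \<and> dir_deriv (x l) (unit_fun w) f = 0" if l: "l < s" for l w
  proof -
    obtain g where "poly_eval (x l) g \<noteq> 0" "g * f \<in> double_point_ideal k n (P l)"
      using g[of l] l by (auto simp: config_ideal_def)
    then show ?thesis
      using double_point_idealD[of "g * f" k n "P l" "x l" "unit_fun w"] x[of l] l
      by (auto simp: poly_eval_hom.hom_mult dir_deriv_mult)
  qed
  moreover have "poly_eval (x (s + l)) f = 0" if l: "l < t" for l
  proof -
    obtain g where "poly_eval (x (s + l)) g \<noteq> 0" "g * f \<in> point_ideal k n (P (s + l))"
      using g[of "s + l"] l by (auto simp: config_ideal_def)
    then show ?thesis
      using vanishing_idealD[of "g * f" "{1..k}" n "{P (s + l)}" "P (s + l)" "x (s + l)"] x[of "s + l"] l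
      by (auto simp: poly_eval_hom.hom_mult point_ideal_def)
  qed
  moreover have "dir_deriv (x (s + t + l)) (unit_fun (1, j)) f = 0" if l: "l < v" and j: "j \<le> n 1" for l j
  proof -
    obtain g where "poly_eval (x (s + t + l)) g \<noteq> 0" "g * f \<in> fibre_double_point_ideal k n (P (s + t + l))"
      using g[of "s + t + l"] l by (auto simp: config_ideal_def)
    then show ?thesis
      using fibre_double_point_idealD[of "g * f" k n "P (s + t + l)" "x (s + t + l)" j]
        P[of "s + t + l"] x[of "s + t + l"] l j \<open>1 \<le> k\<close>
      by (auto simp: poly_eval_hom.hom_mult dir_deriv_mult)
  qed
  ultimately show "f \<in> config_sections k n a s t v x"
    using f by (simp add: config_sections_iff ideal_sections_def)
next
  fix f assume "f \<in> config_sections k n a s t v x"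
  then have f: "f \<in> forms {1..k} n a"
    and p: "\<And>l. l < s \<Longrightarrow> poly_eval (x l) f = 0"
      "\<And>l w. l < s \<Longrightarrow> w \<in> coord_vars {1..k} n \<Longrightarrow> dir_deriv (x l) (unit_fun w) f = 0"
    and q: "\<And>l. l < t \<Longrightarrow> poly_eval (x (s + l)) f = 0"
    and r: "\<And>l j. l < v \<Longrightarrow> j \<le> n 1 \<Longrightarrow> dir_deriv (x (s + t + l)) (unit_fun (1, j)) f = 0"
    unfolding config_sections_iff by blast+
  have "f \<in> double_point_ideal k n (P l)" if "l < s" for l
    using that P[of l] x[of l] p by (intro double_point_idealI[OF f]) auto
  moreover have "f \<in> point_ideal k n (P (s + l))" if "l < t" for l
    unfolding point_ideal_def
    using that vanishes_at_iff[OF f, of "P (s + l)" "x (s + l)"] P[of "s + l"] x[of "s + l"] q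
    by (intro vanishing_idealI[OF f]) auto
  moreover have "f \<in> fibre_double_point_ideal k n (P (s + t + l))" if "l < v" for l
    using that P[of "s + t + l"] x[of "s + t + l"] r
    by (intro fibre_double_point_idealI[OF f assms(1,2)]) auto
  ultimately have J: "1 * f \<in> config_ideal k n s t v P (\<lambda>l. P (s + l)) (\<lambda>l. P (s + t + l))"
    using forms_carrier[OF f] by (simp add: config_ideal_def)
  have "\<not> vanishes_at {1..k} 1 Q" if Q: "Q \<in> mproj_space {1..k} n" for Q
    using homog_coords_nonempty[OF Q] by (auto simp: vanishes_at_def)
  then show "f \<in> ideal_sections {1..k} n
      (config_ideal k n s t v P (\<lambda>l. P (s + l)) (\<lambda>l. P (s + t + l))) a"
    unfolding ideal_sections_def using f J forms_1[of "{1..k}" n] by blast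
qed

section \<open>Tuples of points and generality in coordinates\<close>

lemma dim_forms_expected: "cpoly.dim (forms {1..k} n a) = expected_sections k n a"
  by (simp add: dim_forms expected_sections_def)

text \<open>\<open>z ((l, i), j)\<close> is the \<open>j\<close>-th coordinate on the \<open>i\<close>-th factor of the \<open>l\<close>-th point of a tuple.\<close>

definition tuple_coords :: "nat \<Rightarrow> (nat \<Rightarrow> nat) \<Rightarrow> nat \<Rightarrow> ((nat \<times> nat) \<times> nat \<Rightarrow> complex) set" where
  "tuple_coords k n m = {z. \<forall>l<m. \<forall>i\<in>{1..k}. (\<lambda>j. z ((l, i), j)) \<in> nonzero_vectors (n i)}"

definition nth_coords :: "((nat \<times> nat) \<times> nat \<Rightarrow> complex) \<Rightarrow> nat \<Rightarrow> nat \<times> nat \<Rightarrow> complex" where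
  "nth_coords z l = (\<lambda>(i, j). z ((l, i), j))"

lemma nth_coords_apply [simp]: "nth_coords z l (i, j) = z ((l, i), j)"
  by (simp add: nth_coords_def)

lemma tuple_coords_point:
  assumes "z \<in> tuple_coords k n m"
  shows "\<exists>X \<in> mproj_space ({..<m} \<times> {1..k}) (\<lambda>(l, i). n i). z \<in> homog_coords ({..<m} \<times> {1..k}) X"
proof
  let ?X = "\<lambda>q\<in>{..<m} \<times> {1..k}. scaling_rel `` {\<lambda>j. z (q, j)}"
  show "?X \<in> mproj_space ({..<m} \<times> {1..k}) (\<lambda>(l, i). n i)"
    using assms unfolding mproj_space_def tuple_coords_def
    by (auto intro!: scaling_class_proj_space)
  show "z \<in> homog_coords ({..<m} \<times> {1..k}) ?X"
    using scaling_class_self by (auto simp: homog_coords_def)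
qed

lemma homog_coords_tuple:
  assumes X: "X \<in> mproj_space ({..<m} \<times> {1..k}) (\<lambda>(l, i). n i)"
    and z: "z \<in> homog_coords ({..<m} \<times> {1..k}) X"
  shows "z \<in> tuple_coords k n m"
    and "l < m \<Longrightarrow> tuple_point k X l \<in> mproj_space {1..k} n"
    and "l < m \<Longrightarrow> nth_coords z l \<in> homog_coords {1..k} (tuple_point k X l)"
proof -
  show "z \<in> tuple_coords k n m"
    using homog_coords_nonzero[OF X z] by (fastforce simp: tuple_coords_def)
  show "l < m \<Longrightarrow> tuple_point k X l \<in> mproj_space {1..k} n"
    using X by (fastforce simp: mproj_space_def tuple_point_def)
  show "l < m \<Longrightarrow> nth_coords z l \<in> homog_coords {1..k} (tuple_point k X l)"
    using z by (auto simp: homog_coords_def tuple_point_def)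
qed

lemma hilbert_function_config:
  assumes "1 \<le> k" "a 1 = 1"
    and X: "X \<in> mproj_space ({..<s + t + v} \<times> {1..k}) (\<lambda>(l, i). n i)"
    and z: "z \<in> homog_coords ({..<s + t + v} \<times> {1..k}) X"
  shows "hilbert_function {1..k} n (config_ideal k n s t v (tuple_point k X)
      (\<lambda>l. tuple_point k X (s + l)) (\<lambda>l. tuple_point k X (s + t + l))) a =
    expected_sections k n a - cpoly.dim (config_sections k n a s t v (nth_coords z))"
  unfolding hilbert_function_def dim_forms_expected
  using ideal_sections_config[where a = a and P = "tuple_point k X" and x = "nth_coords z", OF assms(1,2)]
    homog_coords_tuple(2,3)[OF X z] by simp

text \<open>A single form \<open>D\<close> from the family defining the open set, nonzero at one of
  its points, cuts out a smaller nonempty open set. Generality thus becomes the nonvanishing of one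
  form, tested on arbitrary homogeneous coordinates.\<close>

lemma S_true_iff:
  assumes "1 \<le> k" "a 1 = 1"
  shows "S_true k n a s t v \<longleftrightarrow>
    (\<exists>D d z. D \<in> forms ({..<s + t + v} \<times> {1..k}) (\<lambda>(l, i). n i) d \<and>
       z \<in> tuple_coords k n (s + t + v) \<and> poly_eval z D \<noteq> 0 \<and>
       (\<forall>z\<in>tuple_coords k n (s + t + v). poly_eval z D \<noteq> 0 \<longrightarrow>
          expected_sections k n a - cpoly.dim (config_sections k n a s t v (nth_coords z)) =
          min (config_degree k n s t v) (expected_sections k n a)))"
    (is "_ \<longleftrightarrow> (\<exists>D d z. ?R D d z)")
proof
  let ?I = "{..<s + t + v} \<times> {1..k}" and ?n = "\<lambda>(l, i). n i"
  assume "S_true k n a s t v"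
  then obtain U where "zariski_open ?I ?n U" "U \<noteq> {}" and U: "\<And>X. X \<in> U \<Longrightarrow>
      hilbert_function {1..k} n (config_ideal k n s t v (tuple_point k X)
        (\<lambda>l. tuple_point k X (s + l)) (\<lambda>l. tuple_point k X (s + t + l))) a
      = min (config_degree k n s t v) (expected_sections k n a)"
    unfolding S_true_def for_general_points_def by blast
  then obtain T where T: "T \<subseteq> (\<Union>d. forms ?I ?n d)" "U = {P \<in> mproj_space ?I ?n. \<exists>f\<in>T. \<not> vanishes_at ?I f P}"
    unfolding zariski_open_def by blast
  obtain X D where X: "X \<in> mproj_space ?I ?n" "D \<in> T" "\<not> vanishes_at ?I D X"
    using T(2) \<open>U \<noteq> {}\<close> by blast
  then obtain z where z: "z \<in> homog_coords ?I X" "poly_eval z D \<noteq> 0"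
    by (auto simp: vanishes_at_def)
  obtain d where d: "D \<in> forms ?I ?n d"
    using X T(1) by blast
  have "expected_sections k n a - cpoly.dim (config_sections k n a s t v (nth_coords z)) =
      min (config_degree k n s t v) (expected_sections k n a)"
    if z: "z \<in> tuple_coords k n (s + t + v)" "poly_eval z D \<noteq> 0" for z
  proof -
    obtain Y where Y: "Y \<in> mproj_space ?I ?n" "z \<in> homog_coords ?I Y"
      using tuple_coords_point[OF z(1)] by blast
    then have "Y \<in> U"
      using T(2) X(2) z(2) by (auto simp: vanishes_at_def)
    then show ?thesis
      using U[OF \<open>Y \<in> U\<close>] hilbert_function_config[where a = a, OF assms Y] by simp
  qed
  then have "?R D d z"
    using d z homog_coords_tuple(1)[OF X(1) z(1)] by blast
  then show "\<exists>D d z. ?R D d z"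
    by blast
next
  let ?I = "{..<s + t + v} \<times> {1..k}" and ?n = "\<lambda>(l, i). n i"
  assume "\<exists>D d z. ?R D d z"
  then obtain D d z where D: "?R D d z"
    by blast
  let ?U = "{P \<in> mproj_space ?I ?n. \<exists>f\<in>{D}. \<not> vanishes_at ?I f P}"
  have "zariski_open ?I ?n ?U"
    unfolding zariski_open_def using D by (intro exI[of _ "{D}"]) auto
  moreover have "?U \<noteq> {}"
    using tuple_coords_point[of z k n "s + t + v"] D by (auto simp: vanishes_at_def)
  moreover have "hilbert_function {1..k} n (config_ideal k n s t v (tuple_point k X)
        (\<lambda>l. tuple_point k X (s + l)) (\<lambda>l. tuple_point k X (s + t + l))) a
      = min (config_degree k n s t v) (expected_sections k n a)" if "X \<in> ?U" for X
  proof -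
    from that have X: "X \<in> mproj_space ?I ?n" "\<not> vanishes_at ?I D X"
      by auto
    then obtain y where y: "y \<in> homog_coords ?I X" "poly_eval y D \<noteq> 0"
      by (auto simp: vanishes_at_def)
    then show ?thesis
      using hilbert_function_config[where a = a, OF assms X(1) y(1)] homog_coords_tuple(1)[OF X(1) y(1)] D by simp
  qed
  ultimately show "S_true k n a s t v"
    unfolding S_true_def for_general_points_def by blast
qed

section \<open>Semicontinuity and the expected dimension\<close>

lemma point_cond_add: "point_cond x c (f + g) = point_cond x c f + point_cond x c g"
  by (cases "(x, c, f)" rule: point_cond.cases) (simp_all add: poly_eval_hom.hom_add dir_deriv_add)

lemma point_cond_scale: "point_cond x c (poly_scale b f) = b * point_cond x c f"
  by (cases "(x, c, f)" rule: point_cond.cases)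
    (simp_all add: poly_eval_hom.hom_mult dir_deriv_mult poly_scale_eq)

text \<open>The same conditions with the points as variables: for a fixed form, each is a polynomial
  in the coordinates of the \<open>l\<close>-th point. These are the entries of the minors
  below.\<close>

fun cond_poly :: "nat \<times> (nat \<times> nat) option \<Rightarrow> (nat \<times> nat) cpoly \<Rightarrow> ((nat \<times> nat) \<times> nat) cpoly" where
  "cond_poly (l, None) f = poly_subst (\<lambda>(i, j). mvar ((l, i), j)) f"
| "cond_poly (l, Some w) f = poly_subst (\<lambda>(i, j). mvar ((l, i), j)) (partial_deriv w f)"

fun cond_degree :: "(nat \<Rightarrow> nat) \<Rightarrow> nat \<times> (nat \<times> nat) option \<Rightarrow> nat \<times> nat \<Rightarrow> nat" where
  "cond_degree a (l, None) (l', i) = (if l' = l then a i else 0)"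
| "cond_degree a (l, Some w) (l', i) = (if l' = l then (a(fst w := a (fst w) - 1)) i else 0)"

lemma poly_eval_cond_poly: "poly_eval z (cond_poly c f) = point_cond (nth_coords z) c f"
proof -
  have "(\<lambda>w. poly_eval z (case w of (i, j) \<Rightarrow> mvar ((l, i), j))) = nth_coords z l" for l
    by (auto simp: fun_eq_iff)
  then show ?thesis
    by (cases "(c, f)" rule: cond_poly.cases) (simp_all add: poly_eval_subst poly_eval_partial_deriv)
qed

lemma cond_poly_forms:
  assumes "f \<in> forms {1..k} n a" "c \<in> config_conds k n s t v" "1 \<le> k"
  shows "cond_poly c f \<in> forms ({..<s + t + v} \<times> {1..k}) (\<lambda>(l, i). n i) (cond_degree a c)"
proof -
  let ?I = "{..<s + t + v} \<times> {1..k}"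
  have subst: "poly_subst (\<lambda>(i, j). mvar ((l, i), j)) g \<in>
      forms ?I (\<lambda>(l, i). n i) (\<lambda>(l', i). if l' = l then b i else 0)"
    if g: "g \<in> forms {1..k} n b" and l: "l < s + t + v" for g b l
  proof (rule forms_subst[OF g, where \<phi> = "Pair l"])
    fix i j assume "i \<in> {1..k}" "j \<le> n i"
    then have "mvar ((l, i), j) \<in> forms ?I (\<lambda>(l, i). n i) (\<lambda>i'. if i' = (l, i) then 1 else 0)"
      using l by (intro forms_mvar) (simp add: coord_vars_iff)
    then show "(case (i, j) of (i, j) \<Rightarrow> mvar ((l, i), j)) \<in>
        forms ?I (\<lambda>(l, i). n i) (\<lambda>i'. if i' = (l, i) then 1 else 0)"
      by simp
  qed (use l in \<open>auto simp: inj_on_def\<close>)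
  obtain l o' where c: "c = (l, o')"
    by (cases c)
  have l: "l < s + t + v"
    using assms(2) by (auto simp: c config_conds_def)
  show ?thesis
  proof (cases o')
    case None
    have "cond_degree a c = (\<lambda>(l', i). if l' = l then a i else 0)"
      by (auto simp: fun_eq_iff c None)
    then show ?thesis
      using subst[OF assms(1) l] by (simp add: c None)
  next
    case (Some w)
    have "fst w \<in> {1..k}"
      using assms(2,3) by (auto simp: c Some config_conds_def coord_vars_def)
    then have "partial_deriv w f \<in> forms {1..k} n (a(fst w := a (fst w) - 1))"
      using partial_deriv_forms(1)[OF assms(1), of "fst w" "snd w"] by simp
    moreover have "cond_degree a c = (\<lambda>(l', i). if l' = l then (a(fst w := a (fst w) - 1)) i else 0)"
      by (auto simp: fun_eq_iff c Some)
    ultimately show ?thesis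
      using subst[of "partial_deriv w f" "a(fst w := a (fst w) - 1)" l] l by (simp add: c Some)
  qed
qed

lemma forms_uminus: "f \<in> forms I n d \<Longrightarrow> - f \<in> forms I n d"
  using forms_scale[of f I n d "- 1"] by (simp add: cst_hom.hom_uminus)

lemma forms_prod:
  assumes "\<And>i. i \<in> A \<Longrightarrow> f i \<in> forms I n (d i)"
  shows "(\<Prod>i\<in>A. f i) \<in> forms I n (\<lambda>q. \<Sum>i\<in>A. d i q)"
  using assms
proof (induction A rule: infinite_finite_induct)
  case (insert i A)
  have "f i * prod f A \<in> forms I n (\<lambda>q. d i q + (\<Sum>i\<in>A. d i q))"
    using insert by (intro forms_mult) auto
  then show ?case
    using insert by simp
qed (simp_all add: forms_1)

text \<open>The degree of an entry depends on its row alone, so all terms of the Leibniz expansion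
  have the same multidegree.\<close>

lemma det_forms:
  assumes "\<And>i j. i < r \<Longrightarrow> j < r \<Longrightarrow> M i j \<in> forms I n (d i)"
  shows "det (mat r r (\<lambda>(i, j). M i j)) \<in> forms I n (\<lambda>q. \<Sum>i = 0..<r. d i q)"
proof -
  have "signof p * (\<Prod>i = 0..<r. mat r r (\<lambda>(i, j). M i j) $$ (i, p i)) \<in> forms I n (\<lambda>q. \<Sum>i = 0..<r. d i q)"
    if p: "p permutes {0..<r}" for p
  proof -
    have "mat r r (\<lambda>(i, j). M i j) $$ (i, p i) \<in> forms I n (d i)" if "i \<in> {0..<r}" for i
      using that permutes_in_image[OF p, of i] assms by simp
    then have "(\<Prod>i = 0..<r. mat r r (\<lambda>(i, j). M i j) $$ (i, p i)) \<in> forms I n (\<lambda>q. \<Sum>i = 0..<r. d i q)"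
      by (rule forms_prod)
    then show ?thesis
      by (cases "sign p = 1") (auto simp: sign_def forms_uminus split: if_splits)
  qed
  then show ?thesis
    by (subst det_def'[of _ r]) (auto intro!: forms_sum)
qed

text \<open>With \<open>r\<close> the codimension of the system at \<open>z0\<close>,
  \<open>D\<close> is a minor of size \<open>r\<close> of the matrix of conditions. The choice of
  rows and forms makes it triangular with nonzero diagonal at \<open>z0\<close>; wherever
  \<open>D\<close> is nonzero, the codimension is at least \<open>r\<close>.\<close>

lemma config_sections_semicontinuous:
  assumes "1 \<le> k"
  shows "\<exists>D d. D \<in> forms ({..<s + t + v} \<times> {1..k}) (\<lambda>(l, i). n i) d \<and> poly_eval z0 D \<noteq> 0 \<and>
    (\<forall>z. poly_eval z D \<noteq> 0 \<longrightarrow> cpoly.dim (config_sections k n a s t v (nth_coords z)) \<le>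
       cpoly.dim (config_sections k n a s t v (nth_coords z0)))"
proof -
  let ?W = "forms {1..k} n a" and ?C = "config_conds k n s t v"
  let ?K = "\<lambda>z. config_sections k n a s t v (nth_coords z)"
  obtain B where B: "finite B" "?W \<subseteq> cpoly.span B"
    using forms_finite_span[of "{1..k}" n a] by auto
  have "cpoly.dim (?K z0) \<le> cpoly.dim ?W"
    by (rule cpoly.dim_mono_finite[OF B]) (auto simp: config_sections_def)
  then obtain r where r: "cpoly.dim (?K z0) + r = cpoly.dim ?W"
    using le_Suc_ex by metis
  have "\<exists>c f. (\<forall>i<r. c i \<in> ?C \<and> f i \<in> ?W \<and> point_cond (nth_coords z0) (c i) (f i) \<noteq> 0) \<and>
      (\<forall>j<r. \<forall>i<j. point_cond (nth_coords z0) (c i) (f j) = 0)"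
    by (rule cpoly.triangular_family[OF B subspace_forms])
      (use r in \<open>simp_all add: point_cond_add point_cond_scale config_sections_def\<close>)
  then obtain c f where cf: "\<And>i. i < r \<Longrightarrow> c i \<in> ?C" "\<And>i. i < r \<Longrightarrow> f i \<in> ?W"
      "\<And>i. i < r \<Longrightarrow> point_cond (nth_coords z0) (c i) (f i) \<noteq> 0"
      "\<And>i j. j < r \<Longrightarrow> i < j \<Longrightarrow> point_cond (nth_coords z0) (c i) (f j) = 0"
    by blast
  define M where "M = mat r r (\<lambda>(i, j). cond_poly (c i) (f j))"
  have M: "M \<in> carrier_mat r r"
    by (simp add: M_def)
  have "det M \<in> forms ({..<s + t + v} \<times> {1..k}) (\<lambda>(l, i). n i) (\<lambda>q. \<Sum>i = 0..<r. cond_degree a (c i) q)"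
    unfolding M_def using cf(1,2) by (intro det_forms cond_poly_forms[OF _ _ assms])
  moreover have eval: "poly_eval z (det M) = det (mat r r (\<lambda>(i, j). point_cond (nth_coords z) (c i) (f j)))" for z
  proof -
    have "map_mat (poly_eval z) M = mat r r (\<lambda>(i, j). point_cond (nth_coords z) (c i) (f j))"
      by (rule eq_matI) (simp_all add: M_def poly_eval_cond_poly)
    then show ?thesis
      using poly_eval_hom.hom_det[of z M] by simp
  qed
  moreover have "poly_eval z0 (det M) \<noteq> 0"
  proof -
    let ?A = "mat r r (\<lambda>(i, j). point_cond (nth_coords z0) (c i) (f j))"
    have "det ?A = prod_list (diag_mat ?A)"
      by (rule det_lower_triangular[of r]) (simp_all add: cf(4))
    moreover have "0 \<notin> set (diag_mat ?A)"
      using cf(3) by (auto simp: diag_mat_def)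
    ultimately show ?thesis
      by (simp add: eval prod_list_zero_iff)
  qed
  moreover have "cpoly.dim (?K z) \<le> cpoly.dim (?K z0)" if z: "poly_eval z (det M) \<noteq> 0" for z
  proof -
    let ?A = "mat r r (\<lambda>(i, j). point_cond (nth_coords z) (c i) (f j))"
    have A: "?A \<in> carrier_mat r r"
      by simp
    have "cpoly.dim {w \<in> ?W. \<forall>c\<in>?C. point_cond (nth_coords z) c w = 0} + r \<le> cpoly.dim ?W"
    proof (rule cpoly.codim_common_kernel_ge[OF B subspace_forms])
      fix u j
      assume u: "\<And>i. i < r \<Longrightarrow> (\<Sum>j<r. u j * point_cond (nth_coords z) (c i) (f j)) = 0" and j: "j < r"
      have "?A *\<^sub>v vec r u = 0\<^sub>v r"
        using u by (intro eq_vecI)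
          (simp_all add: scalar_prod_def mult.commute atLeast0LessThan)
      then have "vec r u = 0\<^sub>v r"
        using z det_0_iff_vec_prod_zero_field[OF A] vec_carrier[of r u] unfolding eval by blast
      then show "u j = 0"
        using j by (metis index_vec index_zero_vec(1))
    qed (use cf(1,2) in \<open>auto simp: point_cond_add point_cond_scale\<close>)
    then show ?thesis
      using r by (simp add: config_sections_def)
  qed
  ultimately show ?thesis
    by blast
qed

text \<open>The Euler relation of each factor makes one of its partial derivatives redundant; this is why
  a double point imposes at most \<open>1 + \<Sum> n\<close> conditions.\<close>

lemma dim_config_sections_ge:
  assumes z: "z \<in> tuple_coords k n (s + t + v)"
  shows "expected_sections k n a \<le>
    cpoly.dim (config_sections k n a s t v (nth_coords z)) + config_degree k n s t v"
proof -
  let ?W = "forms {1..k} n a" and ?x = "nth_coords z"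
  have "\<exists>c. \<forall>i\<in>{1..k}. c i \<le> n i \<and> ?x l (i, c i) \<noteq> 0" if "l < s" for l
  proof -
    have "(\<lambda>j. ?x l (i, j)) \<in> nonzero_vectors (n i)" if "i \<in> {1..k}" for i
      using z that \<open>l < s\<close> by (simp add: tuple_coords_def)
    then show ?thesis
      by (rule nonzero_coord_choice)
  qed
  then obtain c where c: "\<And>l i. l < s \<Longrightarrow> i \<in> {1..k} \<Longrightarrow> c l i \<le> n i \<and> ?x l (i, c l i) \<noteq> 0"
    by metis
  \<comment> \<open>Omitting an index with nonzero coordinate lets Euler's relation be solved for
    the missing derivative, and leaves \<open>n i\<close> conditions for factor
    \<open>i\<close>.\<close>
  let ?V = "\<lambda>l. SIGMA i:{1..k}. {..n i} - {c l i}"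
  let ?D = "SIGMA l:{..<s}. Some ` ?V l"
  let ?A = "{..<s + t} \<times> {None :: (nat \<times> nat) option}"
  let ?E = "{s + t..<s + t + v} \<times> Some ` ({1::nat} \<times> {..n 1})"
  let ?C = "?A \<union> ?D \<union> ?E"
  have card_V: "card (?V l) = (\<Sum>i\<in>{1..k}. n i)" if "l < s" for l
    using c[OF that] by (simp add: card_SigmaI)
  have "card ?D = s * (\<Sum>i\<in>{1..k}. n i)"
    using card_V by (simp add: card_SigmaI card_image)
  moreover have "card ?E = v * (n 1 + 1)"
    by (simp add: card_cartesian_product card_image)
  moreover have "card ?A = s + t"
    by (simp add: card_cartesian_product)
  moreover have "card ?C \<le> card ?A + card ?D +
      card ?E"
    by (rule order_trans[OF card_Un_le add_right_mono[OF card_Un_le]])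
  ultimately have "card ?C \<le> (s + t) + s * (\<Sum>i\<in>{1..k}. n i) + v * (n 1 + 1)"
    by presburger
  then have card: "card ?C \<le> config_degree k n s t v"
    by (simp add: config_degree_def algebra_simps)
  have fin: "finite ?C"
    by auto
  obtain B where B: "finite B" "?W \<subseteq> cpoly.span B"
    using forms_finite_span[of "{1..k}" n a] by auto
  have "cpoly.dim ?W \<le> cpoly.dim {f \<in> ?W. \<forall>c\<in>?C. point_cond ?x c f = 0} + card ?C"
    by (rule cpoly.dim_le_common_kernel[OF B subspace_forms fin])
      (simp_all add: point_cond_add point_cond_scale)
  moreover have "{f \<in> ?W. \<forall>c\<in>?C. point_cond ?x c f = 0} \<subseteq> config_sections k n a s t v ?x"
  proof
    fix f assume "f \<in> {f \<in> ?W. \<forall>c\<in>?C. point_cond ?x c f = 0}"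
    then have f: "f \<in> ?W" and zero: "\<And>c. c \<in> ?C \<Longrightarrow> point_cond ?x c f = 0"
      by blast+
    have eval: "poly_eval (?x l) f = 0" if "l < s + t" for l
      using zero[of "(l, None)"] that by simp
    have deriv: "dir_deriv (?x l) (unit_fun (i, j)) f = 0" if "l < s" "i \<in> {1..k}" "j \<le> n i" "j \<noteq> c l i" for l i j
      using zero[of "(l, Some (i, j))"] that by simp
    have "dir_deriv (?x l) (unit_fun (i, c l i)) f = 0" if l: "l < s" and i: "i \<in> {1..k}" for l i
    proof -
      have "(\<Sum>j\<le>n i. ?x l (i, j) * dir_deriv (?x l) (unit_fun (i, j)) f) =
          ?x l (i, c l i) * dir_deriv (?x l) (unit_fun (i, c l i)) f"
        using c[OF l i] deriv[OF l i] by (subst sum.remove[of _ "c l i"]) (auto intro!: sum.neutral)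
      then show ?thesis
        using euler_identity[OF f i, of "?x l"] eval[of l] l c[OF l i] by simp
    qed
    then have "dir_deriv (?x l) (unit_fun w) f = 0" if "l < s" "w \<in> coord_vars {1..k} n" for l w
      using that deriv[of l "fst w" "snd w"] by (cases "snd w = c l (fst w)") (auto simp: coord_vars_def)
    moreover have "dir_deriv (?x (s + t + l)) (unit_fun (1, j)) f = 0" if "l < v" "j \<le> n 1" for l j
      using zero[of "(s + t + l, Some (1, j))"] that by simp
    ultimately show "f \<in> config_sections k n a s t v ?x"
      using f eval by (simp add: config_sections_iff)
  qed
  then have "cpoly.dim {f \<in> ?W. \<forall>c\<in>?C. point_cond ?x c f = 0} \<le> cpoly.dim (config_sections k n a s t v ?x)"
    using B by (intro cpoly.dim_mono_finite[OF B(1)]) (auto simp: config_sections_def)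
  ultimately show ?thesis
    using card unfolding dim_forms_expected by linarith
qed

section \<open>Splitting the first factor\<close>

text \<open>\<open>low_subst\<close> and \<open>high_subst\<close> restrict forms to the coordinate subspaces given by the first
  \<open>m\<close> and by the remaining coordinates of the first factor; \<open>shift_subst\<close> pulls back along the
  projection to the second one.\<close>

definition low_subst :: "nat \<Rightarrow> nat \<times> nat \<Rightarrow> (nat \<times> nat) cpoly" where
  "low_subst m = (\<lambda>(i, j). if i = 1 \<and> m \<le> j then 0 else mvar (i, j))"

definition high_subst :: "nat \<Rightarrow> nat \<times> nat \<Rightarrow> (nat \<times> nat) cpoly" where
  "high_subst m = (\<lambda>(i, j). if i = 1 then if j < m then 0 else mvar (1, j - m) else mvar (i, j))"

definition shift_subst :: "nat \<Rightarrow> nat \<times> nat \<Rightarrow> (nat \<times> nat) cpoly" where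
  "shift_subst m = (\<lambda>(i, j). mvar (i, if i = 1 then j + m else j))"

text \<open>The inclusion of the second coordinate subspace, dual to \<open>high_subst\<close>. The
  first one needs no such map: its vectors are already extended by zero.\<close>

definition high_point :: "nat \<Rightarrow> (nat \<times> nat \<Rightarrow> complex) \<Rightarrow> nat \<times> nat \<Rightarrow> complex" where
  "high_point m y = (\<lambda>(i, j). if i = 1 then if j < m then 0 else y (1, j - m) else y (i, j))"

text \<open>Each variable of the first factor is fixed by one of the two composites and killed by
  the other. The induction carries along that both fix forms of degree 0 in that factor, which are
  what such a variable multiplies.\<close>

lemma split_form:
  assumes "f \<in> forms I n d" "1 \<in> I" "d 1 = 1"
  shows "f = poly_subst (low_subst m) f + poly_subst (shift_subst m) (poly_subst (high_subst m) f)"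
proof -
  let ?lo = "poly_subst (low_subst m)" and ?hi = "\<lambda>f. poly_subst (shift_subst m) (poly_subst (high_subst m) f)"
  have "(d 1 = 0 \<longrightarrow> ?lo f = f \<and> ?hi f = f) \<and> (d 1 = 1 \<longrightarrow> f = ?lo f + ?hi f)"
    using assms(1)
  proof (induction rule: forms_induct)
    case (cst d c)
    then show ?case
      using assms(2) by fastforce
  next
    case (mvar d f i j)
    show ?case
    proof (cases "i = 1")
      case True
      then show ?thesis
        using mvar by (cases "j < m")
          (auto simp: poly_subst_hom.hom_mult low_subst_def high_subst_def shift_subst_def)
    next
      case False
      then have eq: "?lo (mvar (i, j) * f) = mvar (i, j) * ?lo f" "?hi (mvar (i, j) * f) = mvar (i, j) * ?hi f"
        by (simp_all add: poly_subst_hom.hom_mult low_subst_def high_subst_def shift_subst_def)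
      then show ?thesis
        unfolding eq distrib_left[symmetric] using mvar False by auto
    qed
  next
    case (add d f g)
    then show ?case
      by (simp add: poly_subst_hom.hom_add algebra_simps)
  qed simp
  then show ?thesis
    using assms(3) by blast
qed

lemma low_subst_forms:
  assumes "f \<in> forms {1..k} n a" "\<forall>i\<in>{2..k}. n' i = n i" "m = Suc (n' 1)"
  shows "poly_subst (low_subst m) f \<in> forms {1..k} n' a"
proof (rule forms_subst[OF assms(1), where \<phi> = id])
  fix i j assume "i \<in> {1..k}" "j \<le> n i"
  then show "low_subst m (i, j) \<in> forms {1..k} n' (\<lambda>i'. if i' = id i then 1 else 0)"
    using assms(2,3) forms_mvar[of i j "{1..k}" n']
    by (cases "i = 1") (auto simp: low_subst_def forms_0 coord_vars_iff)
qed auto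

lemma high_subst_forms:
  assumes "f \<in> forms {1..k} n a" "\<forall>i\<in>{2..k}. n'' i = n i" "n 1 = m + n'' 1"
  shows "poly_subst (high_subst m) f \<in> forms {1..k} n'' a"
proof (rule forms_subst[OF assms(1), where \<phi> = id])
  fix i j assume "i \<in> {1..k}" "j \<le> n i"
  then show "high_subst m (i, j) \<in> forms {1..k} n'' (\<lambda>i'. if i' = id i then 1 else 0)"
    using assms(2,3) forms_mvar[of i j "{1..k}" n''] forms_mvar[of i "j - m" "{1..k}" n'']
    by (cases "i = 1") (auto simp: high_subst_def forms_0 coord_vars_iff)
qed auto

lemma
  assumes y: "\<And>j. j \<ge> m \<Longrightarrow> y (1, j) = 0"
  shows poly_eval_low_subst: "poly_eval y (poly_subst (low_subst m) f) = poly_eval y f"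
    and dir_deriv_low_subst: "i \<noteq> 1 \<or> j < m \<Longrightarrow>
      dir_deriv y (unit_fun (i, j)) (poly_subst (low_subst m) f) = dir_deriv y (unit_fun (i, j)) f"
proof -
  have eq: "(\<lambda>w. poly_eval y (low_subst m w)) = y"
    using y by (auto simp: low_subst_def fun_eq_iff)
  then show "poly_eval y (poly_subst (low_subst m) f) = poly_eval y f"
    by (simp add: poly_eval_subst)
  assume "i \<noteq> 1 \<or> j < m"
  then have "(\<lambda>w. dir_deriv y (unit_fun (i, j)) (low_subst m w)) = unit_fun (i, j)"
    by (auto simp: low_subst_def fun_eq_iff unit_fun_def)
  then show "dir_deriv y (unit_fun (i, j)) (poly_subst (low_subst m) f) = dir_deriv y (unit_fun (i, j)) f"
    using eq by (simp add: dir_deriv_subst)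
qed

lemma poly_eval_high_subst: "poly_eval y (poly_subst (high_subst m) f) = poly_eval (high_point m y) f"
  and dir_deriv_high_subst: "dir_deriv y (unit_fun (i, j)) (poly_subst (high_subst m) f) =
    dir_deriv (high_point m y) (unit_fun (i, if i = 1 then j + m else j)) f"
proof -
  have eq: "(\<lambda>w. poly_eval y (high_subst m w)) = high_point m y"
    by (auto simp: high_subst_def high_point_def fun_eq_iff)
  then show "poly_eval y (poly_subst (high_subst m) f) = poly_eval (high_point m y) f"
    by (simp add: poly_eval_subst)
  have "(\<lambda>w. dir_deriv y (unit_fun (i, j)) (high_subst m w)) = unit_fun (i, if i = 1 then j + m else j)"
    by (auto simp: high_subst_def fun_eq_iff unit_fun_def)
  then show "dir_deriv y (unit_fun (i, j)) (poly_subst (high_subst m) f) =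
      dir_deriv (high_point m y) (unit_fun (i, if i = 1 then j + m else j)) f"
    using eq by (simp add: dir_deriv_subst)
qed

text \<open>A configuration in which every double point and every simple point lies on one of the two
  coordinate subspaces. In the other subspace, the double point leaves a fibre double point: there
  only the tail of its coordinate vector matters.\<close>

definition special_config :: "nat \<Rightarrow> nat \<Rightarrow> nat \<Rightarrow> nat \<Rightarrow> nat \<Rightarrow> (nat \<Rightarrow> nat \<times> nat \<Rightarrow> complex) \<Rightarrow>
    (nat \<Rightarrow> nat \<times> nat \<Rightarrow> complex) \<Rightarrow> nat \<Rightarrow> nat \<times> nat \<Rightarrow> complex" where
  "special_config m s' s'' t' t'' y' y'' l =
     (if l < s' then y' l
      else if l < s' + s'' then high_point m (y'' (l - s'))
      else if l < s' + s'' + t' then y' (s' + (l - (s' + s'')))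
      else if l < s' + s'' + t' + t'' then high_point m (y'' (s'' + (l - (s' + s'' + t'))))
      else y' (s' + t' + (l - (s' + s'' + t' + t''))))"

text \<open>Double and simple points of the subspace in question give their conditions by
  restriction. The fibre conditions involve derivatives along the first factor only, and
  \<open>tail1\<close>, \<open>tail2\<close>, \<open>tail3\<close> identify the tails where they are
  needed with tails where \<open>f\<close> satisfies them.\<close>

lemma
  assumes "1 \<le> k" "a 1 = 1" "\<forall>i\<in>{2..k}. n' i = n i" "\<forall>i\<in>{2..k}. n'' i = n i"
    and n1: "n 1 = n' 1 + n'' 1 + 1" and m: "m = Suc (n' 1)"
    and supp: "\<And>l j. l < s' + t' + (v + s'') \<Longrightarrow> j \<ge> m \<Longrightarrow> y' l (1, j) = 0"
    and tail1: "\<And>l i j. l < v \<Longrightarrow> i \<noteq> 1 \<Longrightarrow> y'' (s'' + t'' + l) (i, j) = y' (s' + t' + l) (i, j)"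
    and tail2: "\<And>l i j. l < s'' \<Longrightarrow> i \<noteq> 1 \<Longrightarrow> y' (s' + t' + (v + l)) (i, j) = y'' l (i, j)"
    and tail3: "\<And>l i j. l < s' \<Longrightarrow> i \<noteq> 1 \<Longrightarrow> y'' (s'' + t'' + (v + l)) (i, j) = y' l (i, j)"
    and f: "f \<in> config_sections k n a (s' + s'') (t' + t'') v (special_config m s' s'' t' t'' y' y'')"
  shows low_config_sections: "poly_subst (low_subst m) f \<in> config_sections k n' a s' t' (v + s'') y'"
    and high_config_sections: "poly_subst (high_subst m) f \<in> config_sections k n'' a s'' t'' (v + s') y''"
proof -
  let ?x = "special_config m s' s'' t' t'' y' y''"
  have form: "f \<in> forms {1..k} n a"
    and p: "\<And>l. l < s' + s'' \<Longrightarrow> poly_eval (?x l) f = 0"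
      "\<And>l w. l < s' + s'' \<Longrightarrow> w \<in> coord_vars {1..k} n \<Longrightarrow> dir_deriv (?x l) (unit_fun w) f = 0"
    and q: "\<And>l. l < t' + t'' \<Longrightarrow> poly_eval (?x (s' + s'' + l)) f = 0"
    and r: "\<And>l j. l < v \<Longrightarrow> j \<le> n 1 \<Longrightarrow> dir_deriv (?x (s' + s'' + (t' + t'') + l)) (unit_fun (1, j)) f = 0"
    using f unfolding config_sections_iff by blast+
  have x1: "?x l = y' l" if "l < s'" for l
    using that by (simp add: special_config_def)
  have x2: "?x (s' + l) = high_point m (y'' l)" if "l < s''" for l
    using that by (simp add: special_config_def)
  have x3: "?x (s' + s'' + l) = y' (s' + l)" if "l < t'" for l
    using that by (simp add: special_config_def)
  have x4: "?x (s' + s'' + (t' + l)) = high_point m (y'' (s'' + l))" if "l < t''" for l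
    using that by (simp add: special_config_def)
  \<comment> \<open>The common fibre double points are represented through \<open>y'\<close>; for
    the second subspace only their tails matter, and these agree by \<open>tail1\<close>.\<close>
  have x5: "?x (s' + s'' + (t' + t'') + l) = y' (s' + t' + l)" for l
    by (simp add: special_config_def)
  have high_tail: "high_point m y (i, j) = y (i, j)" if "i \<noteq> 1" for y i j
    using that by (simp add: high_point_def)
  have head: "dir_deriv y (unit_fun (1, j)) f = dir_deriv y1 (unit_fun (1, j)) f"
    if "\<And>i j. i \<noteq> 1 \<Longrightarrow> y (i, j) = y1 (i, j)" for y y1 j
    using that assms(1,2) by (intro dir_deriv_degree_1[OF form]) auto
  have V1: "(1, j) \<in> coord_vars {1..k} n" if "j \<le> n 1" for j
    using that \<open>1 \<le> k\<close> by (simp add: coord_vars_iff)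
  \<comment> \<open>Any vector sharing its tail with a double point or a fibre double point will do,
    whatever its first block.\<close>
  have r': "dir_deriv y (unit_fun (1, j)) f = 0"
    if "l < s' + s'' \<or> s' + s'' + (t' + t'') \<le> l \<and> l < s' + s'' + (t' + t'') + v"
      "\<And>i j. i \<noteq> 1 \<Longrightarrow> y (i, j) = ?x l (i, j)" "j \<le> n 1" for l y j
  proof -
    have "dir_deriv (?x l) (unit_fun (1, j)) f = 0"
    proof (cases "l < s' + s''")
      case False
      then have "l - (s' + s'' + (t' + t'')) < v" "s' + s'' + (t' + t'') + (l - (s' + s'' + (t' + t''))) = l"
        using that(1) by auto
      then show ?thesis
        using r[of "l - (s' + s'' + (t' + t''))" j] that(3) by simp
    qed (use p(2) V1 that(3) in blast)
    then show ?thesis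
      using head[of y "?x l" j] that(2) by simp
  qed
  show "poly_subst (low_subst m) f \<in> config_sections k n' a s' t' (v + s'') y'"
    unfolding config_sections_iff
  proof (intro conjI allI impI ballI)
    show "poly_subst (low_subst m) f \<in> forms {1..k} n' a"
      by (rule low_subst_forms[OF form assms(3) m])
    fix l assume l: "l < s'"
    show "poly_eval (y' l) (poly_subst (low_subst m) f) = 0"
      using poly_eval_low_subst[of m "y' l" f] supp[of l] p(1)[of l] x1[OF l] l by simp
    fix w assume w: "w \<in> coord_vars {1..k} n'"
    obtain i j where ij: "w = (i, j)" "i \<in> {1..k}" "j \<le> n' i"
      using w by (auto simp: coord_vars_def)
    have "j \<le> n i" "i \<noteq> 1 \<or> j < m"
      using ij assms(3) n1 m by (cases "i = 1"; force)+
    then show "dir_deriv (y' l) (unit_fun w) (poly_subst (low_subst m) f) = 0"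
      using dir_deriv_low_subst[of m "y' l" i j f] supp[of l] p(2)[of l w] x1[OF l] l ij
      by (simp add: coord_vars_iff)
  next
    fix l assume l: "l < t'"
    then show "poly_eval (y' (s' + l)) (poly_subst (low_subst m) f) = 0"
      using poly_eval_low_subst[of m "y' (s' + l)" f] supp[of "s' + l"] q[of l] x3[OF l] by simp
  next
    fix l j assume l: "l < v + s''" and j: "j \<le> n' 1"
    have eq: "dir_deriv (y' (s' + t' + l)) (unit_fun (1, j)) (poly_subst (low_subst m) f) =
        dir_deriv (y' (s' + t' + l)) (unit_fun (1, j)) f"
      using supp[of "s' + t' + l"] l j m by (intro dir_deriv_low_subst) auto
    have j': "j \<le> n 1"
      using j n1 by simp
    show "dir_deriv (y' (s' + t' + l)) (unit_fun (1, j)) (poly_subst (low_subst m) f) = 0"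
    proof (cases "l < v")
      case True
      then show ?thesis
        unfolding eq using x5[of l] j' by (intro r'[of "s' + s'' + (t' + t'') + l"]) auto
    next
      case False
      \<comment> \<open>Fibre points beyond the first \<open>v\<close> are the traces of the double
        points of the second subspace.\<close>
      then have "l - v < s''" "l = v + (l - v)"
        using l by auto
      then have "y' (s' + t' + l) (i, j) = ?x (s' + (l - v)) (i, j)" if "i \<noteq> 1" for i j
        using tail2[of "l - v" i j] x2[of "l - v"] high_tail that by simp
      then show ?thesis
        unfolding eq using \<open>l - v < s''\<close> j' by (intro r'[of "s' + (l - v)"]) auto
    qed
  qed
  show "poly_subst (high_subst m) f \<in> config_sections k n'' a s'' t'' (v + s') y''"
    unfolding config_sections_iff
  proof (intro conjI allI impI ballI)
    show "poly_subst (high_subst m) f \<in> forms {1..k} n'' a"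
      using n1 m by (intro high_subst_forms[OF form assms(4)]) simp
    fix l assume l: "l < s''"
    show "poly_eval (y'' l) (poly_subst (high_subst m) f) = 0"
      using p(1)[of "s' + l"] x2[OF l] l by (simp add: poly_eval_high_subst)
    fix w assume w: "w \<in> coord_vars {1..k} n''"
    obtain i j where ij: "w = (i, j)" "i \<in> {1..k}" "j \<le> n'' i"
      using w by (auto simp: coord_vars_def)
    then have "(i, if i = 1 then j + m else j) \<in> coord_vars {1..k} n"
      using assms(4) n1 m by (cases "i = 1") (auto simp: coord_vars_iff)
    then show "dir_deriv (y'' l) (unit_fun w) (poly_subst (high_subst m) f) = 0"
      unfolding ij(1) dir_deriv_high_subst x2[OF l, symmetric] using l by (intro p(2)) auto
  next
    fix l assume l: "l < t''"
    then show "poly_eval (y'' (s'' + l)) (poly_subst (high_subst m) f) = 0"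
      using q[of "t' + l"] x4[OF l] by (simp add: poly_eval_high_subst)
  next
    fix l j assume l: "l < v + s'" and "j \<le> n'' 1"
    then have j: "j + m \<le> n 1"
      using n1 m by simp
    have eq: "dir_deriv (y'' (s'' + t'' + l)) (unit_fun (1, j)) (poly_subst (high_subst m) f) =
        dir_deriv (high_point m (y'' (s'' + t'' + l))) (unit_fun (1, j + m)) f"
      by (simp add: dir_deriv_high_subst)
    show "dir_deriv (y'' (s'' + t'' + l)) (unit_fun (1, j)) (poly_subst (high_subst m) f) = 0"
    proof (cases "l < v")
      case True
      then show ?thesis
        unfolding eq using x5[of l] tail1 high_tail j by (intro r'[of "s' + s'' + (t' + t'') + l"]) auto
    next
      case False
      then have "l - v < s'" "l = v + (l - v)"
        using l by auto
      then have "high_point m (y'' (s'' + t'' + l)) (i, j) = ?x (l - v) (i, j)" if "i \<noteq> 1" for i j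
        using tail3[of "l - v" i j] x1[of "l - v"] high_tail that by simp
      then show ?thesis
        unfolding eq using \<open>l - v < s'\<close> j by (intro r'[of "l - v"]) auto
    qed
  qed
qed

text \<open>By \<open>split_form\<close>, a basis of \<open>K'\<close> and the pulled back basis of
  \<open>K''\<close> together span \<open>K\<close>.\<close>

lemma dim_sections_le_sum:
  assumes "1 \<le> k" "a 1 = 1" and K: "K \<subseteq> forms {1..k} n a"
    and K': "\<And>f. f \<in> K \<Longrightarrow> poly_subst (low_subst m) f \<in> K'" "K' \<subseteq> forms {1..k} n' a'"
    and K'': "\<And>f. f \<in> K \<Longrightarrow> poly_subst (high_subst m) f \<in> K''" "K'' \<subseteq> forms {1..k} n'' a''"
  shows "cpoly.dim K \<le> cpoly.dim K' + cpoly.dim K''"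
proof -
  let ?up = "poly_subst (shift_subst m)"
  obtain b' where b': "b' \<subseteq> K'" "cpoly.independent b'" "K' \<subseteq> cpoly.span b'" "card b' = cpoly.dim K'"
    by (rule cpoly.basis_exists)
  obtain b'' where b'': "b'' \<subseteq> K''" "cpoly.independent b''" "K'' \<subseteq> cpoly.span b''" "card b'' = cpoly.dim K''"
    by (rule cpoly.basis_exists)
  have fin': "finite b'"
    using forms_finite_span[of "{1..k}" n' a'] b'(1,2) K'(2) cpoly.independent_span_bound[of _ b'] by blast
  have fin'': "finite b''"
    using forms_finite_span[of "{1..k}" n'' a''] b''(1,2) K''(2) cpoly.independent_span_bound[of _ b''] by blast
  have "cpoly.subspace {g. ?up g \<in> cpoly.span (?up ` b'')}"
    unfolding cpoly.subspace_def
  proof (intro conjI ballI allI)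
    fix c g assume "g \<in> {g. ?up g \<in> cpoly.span (?up ` b'')}"
    then have "poly_scale c (?up g) \<in> cpoly.span (?up ` b'')"
      by (intro cpoly.span_scale) simp
    then show "poly_scale c g \<in> {g. ?up g \<in> cpoly.span (?up ` b'')}"
      by (simp add: poly_scale_eq poly_subst_hom.hom_mult)
  qed (simp_all add: cpoly.span_zero cpoly.span_add poly_subst_hom.hom_add)
  then have up: "cpoly.span b'' \<subseteq> {g. ?up g \<in> cpoly.span (?up ` b'')}"
    by (intro cpoly.span_minimal) (auto intro: cpoly.span_base)
  have "K \<subseteq> cpoly.span (b' \<union> ?up ` b'')"
  proof
    fix f assume f: "f \<in> K"
    have "poly_subst (low_subst m) f \<in> cpoly.span (b' \<union> ?up ` b'')"
      using K'(1)[OF f] b'(3) cpoly.span_mono[of b' "b' \<union> ?up ` b''"] by blast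
    moreover have "?up (poly_subst (high_subst m) f) \<in> cpoly.span (b' \<union> ?up ` b'')"
      using K''(1)[OF f] b''(3) up cpoly.span_mono[of "?up ` b''" "b' \<union> ?up ` b''"] by blast
    ultimately have "poly_subst (low_subst m) f + ?up (poly_subst (high_subst m) f) \<in> cpoly.span (b' \<union> ?up ` b'')"
      by (rule cpoly.span_add)
    then show "f \<in> cpoly.span (b' \<union> ?up ` b'')"
      using split_form[of f "{1..k}" n a m] f K assms(1,2) by auto
  qed
  then have "cpoly.dim K \<le> card (b' \<union> ?up ` b'')"
    using fin' fin'' by (intro cpoly.dim_le_card) auto
  also have "\<dots> \<le> card b' + card (?up ` b'')"
    by (rule card_Un_le)
  also have "card (?up ` b'') \<le> card b''"
    using fin'' by (rule card_image_le)
  finally show ?thesis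
    by (simp add: b' b'')
qed

section \<open>Generic configurations\<close>

lemma finite_zeros_on_line:
  assumes "poly_eval (\<lambda>w. x w + t0 * v w) f \<noteq> 0"
  shows "finite {t. poly_eval (\<lambda>w. x w + t * v w) f = 0}"
proof -
  have "on_line x v f \<noteq> 0"
    using assms poly_on_line[of x v f t0] by auto
  then show ?thesis
    using poly_roots_finite[of "on_line x v f"] by (simp add: poly_on_line)
qed

text \<open>Join a tuple with \<open>D' \<noteq> 0\<close> to one with \<open>D'' \<noteq> 0\<close> by a line inside the locus of coinciding
  tails; each condition excludes finitely many points of the line.\<close>

lemma generic_matching_tuples:
  assumes tail: "\<forall>i\<in>{2..k}. n' i = n'' i"
    and D': "D' \<in> forms ({..<s' + t' + (v + s'')} \<times> {1..k}) (\<lambda>(l, i). n' i) d'"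
    and D'': "D'' \<in> forms ({..<s'' + t'' + (v + s')} \<times> {1..k}) (\<lambda>(l, i). n'' i) d''"
    and z': "z' \<in> tuple_coords k n' (s' + t' + (v + s''))" "poly_eval z' D' \<noteq> 0"
    and z'': "z'' \<in> tuple_coords k n'' (s'' + t'' + (v + s'))" "poly_eval z'' D'' \<noteq> 0"
  shows "\<exists>y' y''. y' \<in> tuple_coords k n' (s' + t' + (v + s'')) \<and> poly_eval y' D' \<noteq> 0 \<and>
    y'' \<in> tuple_coords k n'' (s'' + t'' + (v + s')) \<and> poly_eval y'' D'' \<noteq> 0 \<and>
    (\<forall>l<v. \<forall>i j. i \<noteq> 1 \<longrightarrow> y'' ((s'' + t'' + l, i), j) = y' ((s' + t' + l, i), j)) \<and>
    (\<forall>l<s''. \<forall>i j. i \<noteq> 1 \<longrightarrow> y' ((s' + t' + (v + l), i), j) = y'' ((l, i), j)) \<and>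
    (\<forall>l<s'. \<forall>i j. i \<noteq> 1 \<longrightarrow> y'' ((s'' + t'' + (v + l), i), j) = y' ((l, i), j))"
proof -
  let ?m' = "s' + t' + (v + s'')" and ?m'' = "s'' + t'' + (v + s')"
  \<comment> \<open>\<open>\<kappa>\<close> and \<open>\<nu>\<close> match points with a common
    tail: double points with the last fibre points of the other tuple, and the first
    \<open>v\<close> fibre points with each other. Rows marked \<open>own'\<close> or
    \<open>own''\<close>, the first factor and the simple points, are not shared.\<close>
  define \<kappa> where "\<kappa> l = (if l < s' then s'' + t'' + (v + l)
    else if l < s' + t' + v then s'' + t'' + (l - (s' + t')) else l - (s' + t' + v))" for l
  define \<nu> where "\<nu> l = (if l < s'' then s' + t' + (v + l)
    else if l < s'' + t'' + v then s' + t' + (l - (s'' + t'')) else l - (s'' + t'' + v))" for l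
  define own' where "own' l i \<longleftrightarrow> i = 1 \<or> s' \<le> l \<and> l < s' + t'" for l i :: nat
  define own'' where "own'' l i \<longleftrightarrow> i = 1 \<or> s'' \<le> l \<and> l < s'' + t''" for l i :: nat
  \<comment> \<open>The end of the line at \<open>t = 1\<close>: unshared rows of \<open>z'\<close>,
    shared tails of \<open>z''\<close>. \<open>A\<close> completes a first tuple to a second one,
    with unshared rows fixed to those of \<open>z''\<close>, so the tails match by construction for
    every \<open>t\<close>.\<close>
  define w where "w = (\<lambda>((l, i), j). if own' l i then z' ((l, i), j) else z'' ((\<kappa> l, i), j))"
  define A where "A y = (\<lambda>((l, i), j). if own'' l i then z'' ((l, i), j) else y ((\<nu> l, i), j))"
    for y :: "(nat \<times> nat) \<times> nat \<Rightarrow> complex"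
  define y where "y t = (\<lambda>q. z' q + t * (w q - z' q))" for t
  have \<kappa>: "\<kappa> l < ?m''" if "l < ?m'" "\<not> own' l i" for l i
    using that by (auto simp: \<kappa>_def own'_def)
  have \<nu>: "\<nu> l < ?m'" "\<not> own' (\<nu> l) i" "\<kappa> (\<nu> l) = l" if "l < ?m''" "\<not> own'' l i" for l i
    using that by (auto simp: \<nu>_def \<kappa>_def own'_def own''_def)
  have z'_row: "(\<lambda>j. z' ((l, i), j)) \<in> nonzero_vectors (n' i)" if "l < ?m'" "i \<in> {1..k}" for l i
    using z'(1) that by (simp add: tuple_coords_def)
  have z''_row: "(\<lambda>j. z'' ((l, i), j)) \<in> nonzero_vectors (n'' i)" if "l < ?m''" "i \<in> {1..k}" for l i
    using z''(1) that by (simp add: tuple_coords_def)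
  have w_supp: "w ((l, i), j) = 0" if "l < ?m'" "i \<in> {1..k}" "j > n' i" for l i j
  proof (cases "own' l i")
    case True
    then show ?thesis
      using z'_row[OF that(1,2)] that(3) by (simp add: w_def nonzero_vectors_def)
  next
    case False
    then have "i \<in> {2..k}"
      using that(2) by (auto simp: own'_def)
    then show ?thesis
      using z''_row[OF \<kappa>[OF that(1) False] that(2)] that(3) False tail
      by (simp add: w_def nonzero_vectors_def)
  qed
  have "\<exists>j. z' ((l, i), j) \<noteq> 0" if "(l, i) \<in> {..<?m'} \<times> {1..k}" for l i
    using z'_row[of l i] that by (auto simp: nonzero_vectors_def)
  then obtain c where c: "\<And>l i. (l, i) \<in> {..<?m'} \<times> {1..k} \<Longrightarrow> z' ((l, i), c l i) \<noteq> 0"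
    by metis
  have fin1: "finite {t. poly_eval (y t) D' = 0}"
    unfolding y_def using z'(2) by (intro finite_zeros_on_line[of _ 0]) simp
  have A_line: "A (y t) = (\<lambda>q. A z' q + t * (A w q - A z' q))" for t
    by (auto simp: A_def y_def fun_eq_iff)
  \<comment> \<open>On the coordinates that occur in \<open>D''\<close>, completing \<open>w\<close>
    gives back \<open>z''\<close>, since \<open>\<kappa>\<close> undoes \<open>\<nu>\<close> on
    shared rows.\<close>
  have "poly_eval (A w) D'' = poly_eval z'' D''"
  proof (rule poly_eval_cong[OF forms_carrier[OF D'']])
    fix q assume "q \<in> coord_vars ({..<?m''} \<times> {1..k}) (\<lambda>(l, i). n'' i)"
    then obtain l i j where q: "q = ((l, i), j)" "l < ?m''"
      by (auto simp: coord_vars_def)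
    show "A w q = z'' q"
    proof (cases "own'' l i")
      case False
      then show ?thesis
        using \<nu>[OF q(2) False] by (simp add: A_def w_def q(1))
    qed (simp add: A_def q(1))
  qed
  then have fin2: "finite {t. poly_eval (A (y t)) D'' = 0}"
    unfolding A_line using z''(2) by (intro finite_zeros_on_line[of _ 1]) simp
  \<comment> \<open>A coordinate nonzero at \<open>t = 0\<close> vanishes for finitely many
    \<open>t\<close> only; this keeps every row a legitimate vector of homogeneous
    coordinates.\<close>
  have fin3: "finite {t. y t ((l, i), c l i) = 0}" if "(l, i) \<in> {..<?m'} \<times> {1..k}" for l i
    using finite_zeros_on_line[of z' 0 "\<lambda>q. w q - z' q" "mvar ((l, i), c l i)"] c[OF that]
    by (simp add: y_def)
  have "finite ({t. poly_eval (y t) D' = 0} \<union> {t. poly_eval (A (y t)) D'' = 0} \<union>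
      (\<Union>(l, i)\<in>{..<?m'} \<times> {1..k}. {t. y t ((l, i), c l i) = 0}))"
    using fin1 fin2 fin3 by (intro finite_UnI finite_UN_I) auto
  from ex_new_if_finite[OF infinite_UNIV_char_0 this] obtain t where "t \<notin> {t. poly_eval (y t) D' = 0} \<union> {t. poly_eval (A (y t)) D'' = 0} \<union>
      (\<Union>(l, i)\<in>{..<?m'} \<times> {1..k}. {t. y t ((l, i), c l i) = 0})"
    by (elim exE)
  then have t: "poly_eval (y t) D' \<noteq> 0" "poly_eval (A (y t)) D'' \<noteq> 0"
      "\<And>l i. l < ?m' \<Longrightarrow> i \<in> {1..k} \<Longrightarrow> y t ((l, i), c l i) \<noteq> 0"
    by auto
  have y_row: "(\<lambda>j. y t ((l, i), j)) \<in> nonzero_vectors (n' i)" if "l < ?m'" "i \<in> {1..k}" for l i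
    using t(3)[OF that] z'_row[OF that] w_supp[OF that]
    by (auto simp: nonzero_vectors_def y_def)
  have "(\<lambda>j. A (y t) ((l, i), j)) \<in> nonzero_vectors (n'' i)" if l: "l < ?m''" and i: "i \<in> {1..k}" for l i
  proof (cases "own'' l i")
    case True
    then show ?thesis
      using z''_row[OF l i] by (simp add: A_def)
  next
    case False
    then have "i \<in> {2..k}"
      using i by (auto simp: own''_def)
    then have "n'' i = n' i"
      using tail by simp
    then show ?thesis
      using y_row[OF \<nu>(1)[OF l False] i] False by (simp add: A_def)
  qed
  then have "A (y t) \<in> tuple_coords k n'' ?m''"
    by (simp add: tuple_coords_def)
  moreover have "y t \<in> tuple_coords k n' ?m'"
    using y_row by (simp add: tuple_coords_def)
  moreover have "A (y t) ((s'' + t'' + l, i), j) = y t ((s' + t' + l, i), j)" if "l < v" "i \<noteq> 1" for l i j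
    using that by (simp add: A_def own''_def \<nu>_def)
  moreover have "y t ((s' + t' + (v + l), i), j) = A (y t) ((l, i), j)" if "l < s''" "i \<noteq> 1" for l i j
    using that by (simp add: A_def own''_def \<nu>_def)
  moreover have "A (y t) ((s'' + t'' + (v + l), i), j) = y t ((l, i), j)" if "l < s'" "i \<noteq> 1" for l i j
    using that by (simp add: A_def own''_def \<nu>_def)
  ultimately show ?thesis
    using t(1,2) by (intro exI[of _ "y t"] exI[of _ "A (y t)"]) blast
qed

section \<open>The special configuration and its numerical data\<close>

lemma nonzero_vectors_mono: "u \<in> nonzero_vectors p \<Longrightarrow> p \<le> q \<Longrightarrow> u \<in> nonzero_vectors q"
  by (auto simp: nonzero_vectors_def)

lemma high_point_nonzero:
  assumes "(\<lambda>j. y (i, j)) \<in> nonzero_vectors (n'' i)" "i \<noteq> 1 \<Longrightarrow> n'' i = n i" "n 1 = m + n'' 1"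
  shows "(\<lambda>j. high_point m y (i, j)) \<in> nonzero_vectors (n i)"
proof (cases "i = 1")
  case True
  then obtain j where j: "y (1, j) \<noteq> 0"
    using assms(1) by (auto simp: nonzero_vectors_def)
  have "high_point m y (1, j + m) \<noteq> 0"
    using j by (simp add: high_point_def)
  moreover have "high_point m y (1, j) = 0" if "j > n 1" for j
    using that assms(1,3) True by (auto simp: high_point_def nonzero_vectors_def)
  ultimately show ?thesis
    using True by (auto simp: nonzero_vectors_def)
next
  case False
  then show ?thesis
    using assms(1,2) by (simp add: high_point_def)
qed

lemma special_config_nonzero:
  assumes "\<forall>i\<in>{2..k}. n' i = n i" "\<forall>i\<in>{2..k}. n'' i = n i" "n 1 = n' 1 + n'' 1 + 1" "m = Suc (n' 1)"
    and y': "y' \<in> tuple_coords k n' (s' + t' + (v + s''))"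
    and y'': "y'' \<in> tuple_coords k n'' (s'' + t'' + (v + s'))"
  shows "(\<lambda>((l, i), j). special_config m s' s'' t' t'' (nth_coords y') (nth_coords y'') l (i, j))
    \<in> tuple_coords k n (s' + s'' + (t' + t'') + v)"
proof -
  have low: "(\<lambda>j. nth_coords y' l (i, j)) \<in> nonzero_vectors (n i)"
    if "l < s' + t' + (v + s'')" "i \<in> {1..k}" for l i
  proof -
    have "n' i \<le> n i"
      using assms(1,3) that(2) by (cases "i = 1") auto
    moreover have "(\<lambda>j. nth_coords y' l (i, j)) \<in> nonzero_vectors (n' i)"
      using y' that by (simp add: tuple_coords_def)
    ultimately show ?thesis
      by (rule nonzero_vectors_mono[rotated])
  qed
  have high: "(\<lambda>j. high_point m (nth_coords y'' l) (i, j)) \<in> nonzero_vectors (n i)"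
    if "l < s'' + t'' + (v + s')" "i \<in> {1..k}" for l i
    using that y'' assms(2-4) by (intro high_point_nonzero[where n'' = n'']) (auto simp: tuple_coords_def)
  show ?thesis
    unfolding tuple_coords_def special_config_def using low high by auto
qed

text \<open>As \<open>n 1 + 1 = (n' 1 + 1) + (n'' 1 + 1)\<close>, a double point has the degree of a
  double point in one subspace plus a fibre double point in the other, and a fibre double point that
  of one in each.\<close>

lemma config_degree_split:
  assumes "k \<ge> 1" "\<forall>i\<in>{2..k}. n' i = n i" "\<forall>i\<in>{2..k}. n'' i = n i" "n 1 = n' 1 + n'' 1 + 1"
  shows "config_degree k n (s' + s'') (t' + t'') v =
    config_degree k n' s' t' (v + s'') + config_degree k n'' s'' t'' (v + s')"
proof -
  have "{1..k} = insert 1 {2..k}"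
    using assms(1) by auto
  then have sum: "(\<Sum>i\<in>{1..k}. p i) = p 1 + (\<Sum>i\<in>{2..k}. p i)" for p :: "nat \<Rightarrow> nat"
    by simp
  have "(\<Sum>i\<in>{2..k}. n' i) = (\<Sum>i\<in>{2..k}. n i)" "(\<Sum>i\<in>{2..k}. n'' i) = (\<Sum>i\<in>{2..k}. n i)"
    using assms(2,3) by simp_all
  then show ?thesis
    unfolding config_degree_def sum assms(4) by (simp add: algebra_simps)
qed

text \<open>With \<open>a 1 = 1\<close> the first binomial coefficient is \<open>n 1 + 1\<close>,
  which is additive; the others are common to all three spaces.\<close>

lemma expected_sections_split:
  assumes "k \<ge> 1" "a 1 = 1" "\<forall>i\<in>{2..k}. n' i = n i" "\<forall>i\<in>{2..k}. n'' i = n i" "n 1 = n' 1 + n'' 1 + 1"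
  shows "expected_sections k n a = expected_sections k n' a + expected_sections k n'' a"
proof -
  have "{1..k} = insert 1 {2..k}"
    using assms(1) by auto
  then have prod: "(\<Prod>i\<in>{1..k}. p i) = p 1 * (\<Prod>i\<in>{2..k}. p i)" for p :: "nat \<Rightarrow> nat"
    by simp
  have "(\<Prod>i\<in>{2..k}. (n' i + a i) choose (a i)) = (\<Prod>i\<in>{2..k}. (n i + a i) choose (a i))"
    "(\<Prod>i\<in>{2..k}. (n'' i + a i) choose (a i)) = (\<Prod>i\<in>{2..k}. (n i + a i) choose (a i))"
    using assms(3,4) by simp_all
  then show ?thesis
    unfolding expected_sections_def prod assms(2,5) by (simp add: algebra_simps)
qed

lemma dim_config_sections_le: "cpoly.dim (config_sections k n a s t v x) \<le> expected_sections k n a"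
proof -
  obtain B where "finite B" "forms {1..k} n a \<subseteq> cpoly.span B"
    using forms_finite_span[of "{1..k}" n a] by auto
  then show ?thesis
    unfolding dim_forms_expected[symmetric]
    by (rule cpoly.dim_mono_finite) (auto simp: config_sections_def)
qed

theorem theorem2p13:
  fixes k :: nat
    and a n n' n'' :: "nat \<Rightarrow> nat"
    and s s' s'' t t' t'' v :: nat
  assumes "k \<ge> 1"
    and "a 1 = 1"
    and "\<forall>i\<in>{2..k}. n' i = n i"
    and "\<forall>i\<in>{2..k}. n'' i = n i"
    and "n 1 = n' 1 + n'' 1 + 1"
    and "s = s' + s''"
    and "t = t' + t''"
    and "S_true k n' a s' t' (v + s'')"
    and "S_true k n'' a s'' t'' (v + s')"
  shows "(subabundant k n' a s' t' (v + s'') \<and> subabundant k n'' a s'' t'' (v + s')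
            \<longrightarrow> subabundant k n a s t v \<and> S_true k n a s t v)
       \<and> (superabundant k n' a s' t' (v + s'') \<and> superabundant k n'' a s'' t'' (v + s')
            \<longrightarrow> superabundant k n a s t v \<and> S_true k n a s t v)"
proof -
  let ?N = "expected_sections k n a" and ?d = "config_degree k n s t v"
  let ?N' = "expected_sections k n' a" and ?d' = "config_degree k n' s' t' (v + s'')"
  let ?N'' = "expected_sections k n'' a" and ?d'' = "config_degree k n'' s'' t'' (v + s')"
  have N: "?N = ?N' + ?N''"
    by (rule expected_sections_split[where a = a, OF assms(1-5)])
  have d: "?d = ?d' + ?d''"
    unfolding assms(6,7) by (rule config_degree_split[OF assms(1,3-5)])
  define m where "m = Suc (n' 1)"
  obtain D' e' z' where D': "D' \<in> forms ({..<s' + t' + (v + s'')} \<times> {1..k}) (\<lambda>(l, i). n' i) e'"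
      "z' \<in> tuple_coords k n' (s' + t' + (v + s''))" "poly_eval z' D' \<noteq> 0"
      "\<forall>z\<in>tuple_coords k n' (s' + t' + (v + s'')). poly_eval z D' \<noteq> 0 \<longrightarrow>
         ?N' - cpoly.dim (config_sections k n' a s' t' (v + s'') (nth_coords z)) = min ?d' ?N'"
    using assms(8) unfolding S_true_iff[where a = a, OF assms(1,2)] by blast
  obtain D'' e'' z'' where D'': "D'' \<in> forms ({..<s'' + t'' + (v + s')} \<times> {1..k}) (\<lambda>(l, i). n'' i) e''"
      "z'' \<in> tuple_coords k n'' (s'' + t'' + (v + s'))" "poly_eval z'' D'' \<noteq> 0"
      "\<forall>z\<in>tuple_coords k n'' (s'' + t'' + (v + s')). poly_eval z D'' \<noteq> 0 \<longrightarrow>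
         ?N'' - cpoly.dim (config_sections k n'' a s'' t'' (v + s') (nth_coords z)) = min ?d'' ?N''"
    using assms(9) unfolding S_true_iff[where a = a, OF assms(1,2)] by blast
  have tail: "\<forall>i\<in>{2..k}. n' i = n'' i"
    using assms(3,4) by simp
  obtain y' y'' where y': "y' \<in> tuple_coords k n' (s' + t' + (v + s''))" "poly_eval y' D' \<noteq> 0"
    and y'': "y'' \<in> tuple_coords k n'' (s'' + t'' + (v + s'))" "poly_eval y'' D'' \<noteq> 0"
    and tails: "\<forall>l<v. \<forall>i j. i \<noteq> 1 \<longrightarrow> y'' ((s'' + t'' + l, i), j) = y' ((s' + t' + l, i), j)"
      "\<forall>l<s''. \<forall>i j. i \<noteq> 1 \<longrightarrow> y' ((s' + t' + (v + l), i), j) = y'' ((l, i), j)"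
      "\<forall>l<s'. \<forall>i j. i \<noteq> 1 \<longrightarrow> y'' ((s'' + t'' + (v + l), i), j) = y' ((l, i), j)"
    using generic_matching_tuples[OF tail D'(1) D''(1) D'(2,3) D''(2,3)] by (elim exE conjE) (rule that)
  let ?x = "special_config m s' s'' t' t'' (nth_coords y') (nth_coords y'')"
  let ?K' = "config_sections k n' a s' t' (v + s'') (nth_coords y')"
  let ?K'' = "config_sections k n'' a s'' t'' (v + s') (nth_coords y'')"
  define z where "z = (\<lambda>((l, i), j). ?x l (i, j))"
  have z: "z \<in> tuple_coords k n (s + t + v)"
    unfolding z_def assms(6,7) by (rule special_config_nonzero[OF assms(3-5) m_def y'(1) y''(1)])
  have nth_z: "nth_coords z = ?x"
    by (auto simp: fun_eq_iff z_def)
  have supp: "nth_coords y' l (1, j) = 0" if "l < s' + t' + (v + s'')" "j \<ge> m" for l j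
    using y'(1) that \<open>k \<ge> 1\<close> by (auto simp: tuple_coords_def nonzero_vectors_def m_def)
  have "cpoly.dim (config_sections k n a s t v (nth_coords z)) \<le> cpoly.dim ?K' + cpoly.dim ?K''"
  proof (rule dim_sections_le_sum[where m = m and a = a and n = n and n' = n' and n'' = n'' and a' = a and a'' = a, OF assms(1,2)])
    fix f assume f: "f \<in> config_sections k n a s t v (nth_coords z)"
    show "poly_subst (low_subst m) f \<in> ?K'"
      by (rule low_config_sections[where a = a and n = n and n' = n' and n'' = n'', OF assms(1-5) m_def supp _ _ _ f[unfolded nth_z assms(6,7)]])
        (simp_all add: tails)
    show "poly_subst (high_subst m) f \<in> ?K''"
      by (rule high_config_sections[where a = a and n = n and n' = n' and n'' = n'', OF assms(1-5) m_def supp _ _ _ f[unfolded nth_z assms(6,7)]])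
        (simp_all add: tails)
  qed (auto simp: config_sections_def)
  moreover obtain D e where D: "D \<in> forms ({..<s + t + v} \<times> {1..k}) (\<lambda>(l, i). n i) e" "poly_eval z D \<noteq> 0"
      "\<forall>y. poly_eval y D \<noteq> 0 \<longrightarrow> cpoly.dim (config_sections k n a s t v (nth_coords y)) \<le>
         cpoly.dim (config_sections k n a s t v (nth_coords z))"
    using config_sections_semicontinuous[OF assms(1)] by blast
  ultimately have le: "cpoly.dim (config_sections k n a s t v (nth_coords y)) \<le> cpoly.dim ?K' + cpoly.dim ?K''"
    if "poly_eval y D \<noteq> 0" for y
    using that order_trans by blast
  \<comment> \<open>The second bound makes the natural number subtraction exact.\<close>
  have K': "?N' - cpoly.dim ?K' = min ?d' ?N'" "cpoly.dim ?K' \<le> ?N'"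
    using D'(4) y' dim_config_sections_le by blast+
  have K'': "?N'' - cpoly.dim ?K'' = min ?d'' ?N''" "cpoly.dim ?K'' \<le> ?N''"
    using D''(4) y'' dim_config_sections_le by blast+
  \<comment> \<open>In the first case the two systems have dimensions \<open>?N' - ?d'\<close> and
    \<open>?N'' - ?d''\<close>, whose sum is the general lower bound \<open>?N - ?d\<close>; in the
    second case both are zero.\<close>
  have "S_true k n a s t v" if "?d' \<le> ?N' \<and> ?d'' \<le> ?N'' \<or> ?N' \<le> ?d' \<and> ?N'' \<le> ?d''"
  proof -
    have "?N - cpoly.dim (config_sections k n a s t v (nth_coords y)) = min ?d ?N"
      if "y \<in> tuple_coords k n (s + t + v)" "poly_eval y D \<noteq> 0" for y
      using le[OF that(2)] dim_config_sections_ge[OF that(1), of a] K' K'' N d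
        \<open>?d' \<le> ?N' \<and> ?d'' \<le> ?N'' \<or> ?N' \<le> ?d' \<and> ?N'' \<le> ?d''\<close> by linarith
    then show ?thesis
      unfolding S_true_iff[where a = a, OF assms(1,2)] using D z by blast
  qed
  then show ?thesis
    unfolding subabundant_def superabundant_def using N d by auto
qed

end
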